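(* Let $\alpha\in(1,2)$ and $\varepsilon\in(0,1)$ be fixed, and consider the random graph model M1 with parameter $\alpha$ on $n$ nodes. Let $q_c>0$, $q_l>0$, $|r|\le q_c$ be fixed parameters with $2q_c+q_l\le 1$, let $d=d(\alpha)$, and let $P$ be the transition matrix of the homogeneous Markov chain with parameters $q_c,q_l,r,d$ on a random graph from M1; suppose that this chain is lazy asymptotically almost surely. Then there are constants $c_1,c_2>0$ not depending on $n$ such that asymptotically almost surely as $n\to\infty$ $$c_1 n^{\alpha-1} < t_{\rm mix}(P,\varepsilon) < c_2\, d(\alpha)^2\, n^{2\alpha-2}\log n .$$
   Context: Mixing time: for a Markov chain with transition matrix $P$ on a finite set $\mathcal X$ with unique stationary distribution $\pi$, $t_{\rm mix}(P,\varepsilon)=\max_{\sigma}\min\{k:\|\sigma P^k-\pi\|_{\rm TV}\le\varepsilon\}$, the maximum being over probability distributions $\sigma$ on $\mathcal X$, where $\|\mu-\nu\|_{\rm TV}=\max_{A\subseteq\mathcal X}|\mu(A)-\nu(A)|$. A chain is lazy if $p_{ii}\ge 1/2$ for all states $i$. Model M1: start with the cycle on the nodes $0,1,\dots,n-1$ (node $i$ adjacent to $i\pm1$ mod $n$). Put $k=\lfloor n^{2-\alpha}\rfloor$, take the $2k$ almost equidistant nodes $\lfloor i n^{\alpha-1}/2\rfloor$, $0\le i<2k$, and add the edges of a uniformly random perfect matching on these $2k$ nodes. The added edges are called long range edges. Homogeneous chain with parameters $q_c,q_l,r,d$: every clockwise transition along the cycle has probability $q_c+r$, every counterclockwise transition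 along the cycle has probability $q_c-r$, each long range edge is used (in each direction) with probability $q_l/d$, and with the remaining probability the chain stays put. If a long range edge coincides with a cycle edge, the probabilities add up. Its stationary distribution is uniform. $d(\alpha)$ denotes a fixed constant, depending only on $\alpha$, such that asymptotically almost surely no node of the random graph has more than $d(\alpha)$ long range edges (such a constant exists; with $d=d(\alpha)$ and $2q_c+q_l\le1$ the homogeneous chain is a proper Markov chain asymptotically almost surely). "Asymptotically almost surely" means with probability tending to 1 as $n\to\infty$. Constants may depend on the fixed parameters $\alpha,\varepsilon,q_c,q_l,r$ but not on $n$. *)

theory Defs
  imports "HOL-Probability.Probability"
begin

text \<open>
  Transition matrices on a finite set \<open>X\<close> are real-valued functions \<open>P\<close>, of which only the
  entries \<open>P x y\<close> with \<open>x, y \<in> X\<close> matter.  Probability distributions on \<open>X\<close> are values of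
  type \<open>'a pmf\<close> whose support is contained in \<open>X\<close>; row vectors are functions \<open>'a \<Rightarrow> real\<close>.
\<close>

definition dist_step :: "'a set \<Rightarrow> ('a \<Rightarrow> 'a \<Rightarrow> real) \<Rightarrow> ('a \<Rightarrow> real) \<Rightarrow> 'a \<Rightarrow> real" where
  "dist_step X P \<mu> = (\<lambda>y. \<Sum>x\<in>X. \<mu> x * P x y)"

definition distributions_on :: "'a set \<Rightarrow> 'a pmf set" where
  "distributions_on X = {\<sigma>. set_pmf \<sigma> \<subseteq> X}"

definition is_stationary :: "'a set \<Rightarrow> ('a \<Rightarrow> 'a \<Rightarrow> real) \<Rightarrow> 'a pmf \<Rightarrow> bool" where
  "is_stationary X P \<pi> \<longleftrightarrow>
     \<pi> \<in> distributions_on X \<and> (\<forall>y\<in>X. dist_step X P (pmf \<pi>) y = pmf \<pi> y)"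

definition stationary_dist :: "'a set \<Rightarrow> ('a \<Rightarrow> 'a \<Rightarrow> real) \<Rightarrow> 'a pmf" where
  "stationary_dist X P = (THE \<pi>. is_stationary X P \<pi>)"

definition tv_norm :: "'a set \<Rightarrow> ('a \<Rightarrow> real) \<Rightarrow> ('a \<Rightarrow> real) \<Rightarrow> real" where
  "tv_norm X \<mu> \<nu> = Max ((\<lambda>A. \<bar>sum \<mu> A - sum \<nu> A\<bar>) ` Pow X)"

text \<open>
  The mixing time takes values in \<^typ>\<open>enat\<close>, so that it is \<open>\<infinity>\<close> (rather than an arbitrary
  number) if some initial distribution never gets within \<open>\<epsilon>\<close> of stationarity or if the times
  are unbounded.  When it is finite, the supremum and the infimum are a maximum and a minimum.
\<close>

definition t_mix :: "'a set \<Rightarrow> ('a \<Rightarrow> 'a \<Rightarrow> real) \<Rightarrow> real \<Rightarrow> enat" where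
  "t_mix X P \<epsilon> =
     (SUP \<sigma>\<in>distributions_on X.
        INF k\<in>{k. tv_norm X ((dist_step X P ^^ k) (pmf \<sigma>)) (pmf (stationary_dist X P)) \<le> \<epsilon>}.
          enat k)"

definition lazy_chain :: "'a set \<Rightarrow> ('a \<Rightarrow> 'a \<Rightarrow> real) \<Rightarrow> bool" where
  "lazy_chain X P \<longleftrightarrow> (\<forall>x\<in>X. P x x \<ge> 1 / 2)"

text \<open>
  The nodes are \<open>{..<n}\<close>.  The selected nodes are pairwise distinct as soon as
  \<open>n powr (\<alpha> - 1) \<ge> 2\<close>, hence for all but finitely many \<open>n\<close> if \<open>\<alpha> > 1\<close>.  For the
  finitely many other \<open>n\<close> a perfect matching need not exist, and then \<open>M1\<close> is
  unspecified; this is irrelevant for asymptotic statements.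
\<close>

definition hubs :: "real \<Rightarrow> nat \<Rightarrow> nat set" where
  "hubs \<alpha> n =
     (\<lambda>i. nat \<lfloor>real i * real n powr (\<alpha> - 1) / 2\<rfloor>) ` {..<2 * nat \<lfloor>real n powr (2 - \<alpha>)\<rfloor>}"

definition perfect_matchings :: "'a set \<Rightarrow> 'a set set set" where
  "perfect_matchings H = {M. partition_on H M \<and> (\<forall>e\<in>M. card e = 2)}"

text \<open>
  As the cycle is deterministic, a random graph from M1 is represented by its set of long range
  edges (each edge being a two-element set of nodes).
\<close>

definition M1 :: "real \<Rightarrow> nat \<Rightarrow> nat set set pmf" where
  "M1 \<alpha> n = pmf_of_set (perfect_matchings (hubs \<alpha> n))"

definition aas_M1 :: "real \<Rightarrow> (nat \<Rightarrow> nat set set \<Rightarrow> bool) \<Rightarrow> bool" where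
  "aas_M1 \<alpha> Q \<longleftrightarrow> (\<lambda>n. measure_pmf.prob (M1 \<alpha> n) {M. Q n M}) \<longlonglongrightarrow> 1"

definition long_degree_le :: "real \<Rightarrow> nat \<Rightarrow> nat set set \<Rightarrow> bool" where
  "long_degree_le d n M \<longleftrightarrow> (\<forall>x<n. real (card {e\<in>M. x \<in> e}) \<le> d)"

definition move_prob ::
  "real \<Rightarrow> real \<Rightarrow> real \<Rightarrow> real \<Rightarrow> nat \<Rightarrow> nat set set \<Rightarrow> nat \<Rightarrow> nat \<Rightarrow> real" where
  "move_prob q\<^sub>c q\<^sub>l r d n M x y =
     (if y = (x + 1) mod n then q\<^sub>c + r else 0) +
     (if x = (y + 1) mod n then q\<^sub>c - r else 0) +
     (if {x, y} \<in> M then q\<^sub>l / d else 0)"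

definition hom_chain ::
  "real \<Rightarrow> real \<Rightarrow> real \<Rightarrow> real \<Rightarrow> nat \<Rightarrow> nat set set \<Rightarrow> nat \<Rightarrow> nat \<Rightarrow> real" where
  "hom_chain q\<^sub>c q\<^sub>l r d n M x y =
     (if x = y then 1 - (\<Sum>z\<in>{..<n} - {x}. move_prob q\<^sub>c q\<^sub>l r d n M x z)
      else move_prob q\<^sub>c q\<^sub>l r d n M x y)"

end

theory Submission
  imports Defs "HOL-Real_Asymp.Real_Asymp"
begin

text \<open>
  Since the hubs are distinct for large \<open>n\<close>, every hub carries exactly one long range edge.

  Upper bound: contracting the segments between consecutive hubs yields a cycle plus a uniformly
  random perfect matching.  A union bound over sets with few cycle boundary edges shows that this
  graph has edge expansion bounded below asymptotically almost surely, so Cheeger's inequality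
  gives it a Poincare inequality with an absolute constant.  Reinserting the segments, of
  length \<open>O(n powr (\<alpha> - 1))\<close>, multiplies the constant by the square of that length.  For a
  lazy doubly stochastic chain the Poincare inequality for the symmetrised chain still contracts
  the \<open>\<ell>\<^sup>2\<close> distance to the uniform distribution, even though the chain is not reversible.

  Lower bound: a walk started in the middle of a segment does not meet a hub for order
  \<open>n powr (\<alpha> - 1)\<close> steps, hence stays in a set of vanishing stationary probability.
\<close>

section \<open>Perfect matchings\<close>

text \<open>The matching alone has no expansion: any union of its edges is matched within itself. In
  numbers, a set of \<open>s\<close> out of \<open>m\<close> hubs is matched within itself with
  probability \<open>(s / m) ^ (s / 2)\<close>, up to factors exponential in \<open>s\<close>, which
  cannot beat the roughly \<open>(m / s) ^ s\<close> sets of that size. The cycle rescues the union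
  bound: only about \<open>(m / s) ^ (s / 256)\<close> sets have at most \<open>s / 256\<close>
  boundary edges, and all others expand along the cycle. The drift \<open>r\<close> destroys
  reversibility, so the argument works with energies, in which \<open>r\<close> cancels, instead of
  eigenvalues. As \<open>stationary_dist\<close> is a definite description, the lower bound also
  needs a Poincare inequality, in order to know that the stationary distribution is uniform. Hence
  both bounds are proved on the event of expansion. The argument yields a factor \<open>d\<close>,
  and \<open>d\<^sup>2\<close> follows since \<open>d \<ge> 1\<close>: every hub carries a long
  range edge.\<close>

lemma perfect_matchings_finite: "finite H \<Longrightarrow> finite (perfect_matchings H)"
  by (rule finite_subset[of _ "Pow (Pow H)"])
     (auto simp only: perfect_matchings_def partition_on_def mem_Collect_eq Pow_iff finite_Pow_iff)

lemma perfect_matchings_insert: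
  assumes "x \<in> H"
  shows "perfect_matchings H = (\<Union>y\<in>H - {x}. insert {x, y} ` perfect_matchings (H - {x, y}))"
proof (intro equalityI subsetI)
  fix M assume M: "M \<in> perfect_matchings H"
  then have U: "\<Union>M = H" and dis: "disjoint M" and c2: "\<And>e. e \<in> M \<Longrightarrow> card e = 2"
    by (auto simp: perfect_matchings_def partition_on_def)
  from U assms obtain e where e: "e \<in> M" "x \<in> e" by blast
  then obtain y where y: "e = {x, y}" "y \<noteq> x"
    using c2[OF e(1)] by (metis card_2_iff doubleton_eq_iff insert_iff singleton_iff)
  have yH: "y \<in> H - {x}" using U e y by auto
  have "e' \<inter> {x, y} = {}" if "e' \<in> M - {{x, y}}" for e'
    using dis e y that by (auto simp: disjoint_def pairwise_def disjnt_def)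
  moreover have "\<Union>(M - {{x, y}}) \<union> {x, y} = H" using U e y by auto
  ultimately have "\<Union>(M - {{x, y}}) = H - {x, y}" by blast
  moreover have "disjoint (M - {{x, y}})" using dis by (auto simp: disjoint_def pairwise_def)
  ultimately have "M - {{x, y}} \<in> perfect_matchings (H - {x, y})"
    using M by (auto simp: perfect_matchings_def partition_on_def)
  moreover have "M = insert {x, y} (M - {{x, y}})" using e y by auto
  ultimately show "M \<in> (\<Union>y\<in>H - {x}. insert {x, y} ` perfect_matchings (H - {x, y}))"
    using yH by blast
next
  fix M assume "M \<in> (\<Union>y\<in>H - {x}. insert {x, y} ` perfect_matchings (H - {x, y}))"
  then obtain y M' where y: "y \<in> H" "y \<noteq> x" and M': "M' \<in> perfect_matchings (H - {x, y})"
    and M: "M = insert {x, y} M'" by blast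
  have U: "\<Union>M' = H - {x, y}" and dis: "disjoint M'" and ne: "{} \<notin> M'"
    and c2: "\<forall>e\<in>M'. card e = 2"
    using M' by (auto simp: perfect_matchings_def partition_on_def)
  have "{x, y} \<inter> e = {}" if "e \<in> M'" for e using U that by blast
  then have "disjoint M" using dis unfolding M pairwise_insert by (auto simp: disjnt_def)
  moreover have "\<Union>M = H" unfolding M Union_insert U using y assms by auto
  moreover have "card {x, y} = 2" using y by auto
  ultimately show "M \<in> perfect_matchings H"
    using c2 ne unfolding M perfect_matchings_def partition_on_def by auto
qed

text \<open>The pieces are disjoint because matchings from different pieces give \<open>x\<close>
  different partners. The predicate \<open>Q\<close> lets one recursion count all matchings as well
  as the saturated ones.\<close>

lemma card_perfect_matchings_insert:
  assumes "finite H" "x \<in> H"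
  shows "card {M \<in> perfect_matchings H. Q M} =
    (\<Sum>y\<in>H - {x}. card {M \<in> perfect_matchings (H - {x, y}). Q (insert {x, y} M)})"
proof -
  define R where "R y = {M \<in> perfect_matchings (H - {x, y}). Q (insert {x, y} M)}" for y
  have mem: "e \<subseteq> H - {x, y}" if "M \<in> perfect_matchings (H - {x, y})" "e \<in> M" for e y M
    using that by (auto simp: perfect_matchings_def partition_on_def)
  have inj: "inj_on (insert {x, y}) (R y)" for y
  proof (rule inj_onI)
    fix M M' assume "M \<in> R y" "M' \<in> R y" and eq: "insert {x, y} M = insert {x, y} M'"
    then have "{x, y} \<notin> M" "{x, y} \<notin> M'" using mem unfolding R_def by blast+
    with eq show "M = M'" by (metis Diff_insert_absorb)
  qed
  have dis: "insert {x, y} ` R y \<inter> insert {x, z} ` R z = {}" if "y \<noteq> z" for y z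
  proof (rule ccontr)
    assume "\<not> ?thesis"
    then obtain M M' where "M \<in> R y" "M' \<in> R z" "insert {x, y} M = insert {x, z} M'" by blast
    moreover have "{x, y} \<noteq> {x, z}" using that by (auto simp: doubleton_eq_iff)
    ultimately have "{x, y} \<in> M'" by blast
    then show False using mem \<open>M' \<in> R z\<close> unfolding R_def by blast
  qed
  have "{M \<in> perfect_matchings H. Q M} = (\<Union>y\<in>H - {x}. insert {x, y} ` R y)"
    unfolding perfect_matchings_insert[OF assms(2)] by (auto simp: R_def)
  also have "card \<dots> = (\<Sum>y\<in>H - {x}. card (insert {x, y} ` R y))"
  proof (intro card_UN_disjoint ballI impI)
    show "finite (insert {x, y} ` R y)" for y
      using assms(1) by (simp add: R_def perfect_matchings_finite)
  qed (use assms dis in \<open>simp_all\<close>)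
  also have "\<dots> = (\<Sum>y\<in>H - {x}. card (R y))"
    by (intro sum.cong refl card_image inj)
  finally show ?thesis by (simp add: R_def)
qed

text \<open>The double factorial \<open>(h - 1)!!\<close> for even \<open>h\<close>, and 0 for odd
  \<open>h\<close>.\<close>

fun num_matchings :: "nat \<Rightarrow> nat" where
  "num_matchings 0 = 1"
| "num_matchings (Suc 0) = 0"
| "num_matchings (Suc (Suc h)) = Suc h * num_matchings h"

lemma card_perfect_matchings:
  "finite H \<Longrightarrow> card (perfect_matchings H) = num_matchings (card H)"
proof (induction "card H" arbitrary: H rule: num_matchings.induct)
  case 1
  then have "perfect_matchings H = {{}}"
    by (auto simp: perfect_matchings_def partition_on_def)
  with 1 show ?case by simp
next
  case 2
  then obtain x where "H = {x}" by (metis card_1_singletonE One_nat_def)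
  with 2 show ?case by (simp add: perfect_matchings_insert[of x])
next
  case (3 h)
  then obtain x where x: "x \<in> H" by (metis card.empty ex_in_conv nat.distinct(1))
  have "card (H - {x, y}) = h" if "y \<in> H - {x}" for y
    using 3(2,3) x that by (auto simp: card_Diff_subset card_insert_if)
  then have "card (perfect_matchings (H - {x, y})) = num_matchings h" if "y \<in> H - {x}" for y
    using 3 that by simp
  moreover have "card (perfect_matchings H) =
    (\<Sum>y\<in>H - {x}. card (perfect_matchings (H - {x, y})))"
    using card_perfect_matchings_insert[OF 3(3) x, of "\<lambda>_. True"] by simp
  ultimately show ?case using 3(3) x by (simp flip: 3(2))
qed

lemma num_matchings_pos: "even h \<Longrightarrow> num_matchings h > 0"
  by (induction h rule: num_matchings.induct) auto

lemma perfect_matchings_nonempty: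
  "finite H \<Longrightarrow> even (card H) \<Longrightarrow> perfect_matchings H \<noteq> {}"
  by (metis card.empty card_perfect_matchings less_irrefl num_matchings_pos)

definition saturated :: "'a set \<Rightarrow> 'a set set \<Rightarrow> bool" where
  "saturated U M \<longleftrightarrow> (\<forall>e\<in>M. e \<subseteq> U \<or> e \<inter> U = {})"

text \<open>Reveal the partner of a point of \<open>U\<close>: it lies in \<open>U\<close> with
  probability \<open>(u - 1) / (h - 1) \<le> u / h\<close>, and what remains is the same question
  for \<open>u - 2\<close> and \<open>h - 2\<close> points, whose ratio is no larger. A factor
  \<open>u / h\<close> is gained per two points of \<open>U\<close>, whence the square root.\<close>

lemma card_saturated_matchings_le:
  assumes "finite H" "U \<subseteq> H"
  shows "real (card {M \<in> perfect_matchings H. saturated U M}) \<le>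
    sqrt (real (card U) / real (card H)) ^ card U * real (card (perfect_matchings H))"
  using assms
proof (induction "card U" arbitrary: U H rule: less_induct)
  case less
  have finU: "finite U" using less.prems finite_subset by blast
  show ?case
  proof (cases "U = {}")
    case True
    then show ?thesis by (simp add: saturated_def)
  next
    case False
    then obtain x where x: "x \<in> U" by blast
    define u h where "u = card U" and "h = card H"
    have uh: "u \<le> h" using less.prems by (simp add: u_def h_def card_mono)
    have u1: "u \<ge> 1" using False finU by (simp add: u_def Suc_le_eq card_gt_0_iff)
    define R where "R y = {M \<in> perfect_matchings (H - {x, y}). saturated U (insert {x, y} M)}" for y
    have R1: "R y = {}" if "y \<in> H - U" for y
      using that x by (auto simp: R_def saturated_def)
    have R2: "R y \<subseteq> {M \<in> perfect_matchings (H - {x, y}). saturated (U - {x, y}) M}"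
      if "y \<in> U - {x}" for y
    proof
      fix M assume M: "M \<in> R y"
      then have "e \<inter> {x, y} = {}" if "e \<in> M" for e
        using that by (auto simp: R_def perfect_matchings_def partition_on_def)
      with M show "M \<in> {M \<in> perfect_matchings (H - {x, y}). saturated (U - {x, y}) M}"
        unfolding R_def saturated_def by blast
    qed
    define B where "B = sqrt (real (u - 2) / real (h - 2)) ^ (u - 2) * real (num_matchings (h - 2))"
    have le: "real (card (R y)) \<le> B" if y: "y \<in> U - {x}" for y
    proof -
      have cU: "card (U - {x, y}) = u - 2" and cH: "card (H - {x, y}) = h - 2"
        using x y subsetD[OF less.prems(2)] less.prems(1) finU
        by (auto simp: card_Diff_subset card_insert_if u_def h_def)
      have "{x, y} \<subseteq> U" "card {x, y} = 2" using x y by auto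
      then have "u \<ge> 2" using card_mono[OF finU, of "{x, y}"] by (simp add: u_def)
      have "card (R y) \<le> card {M \<in> perfect_matchings (H - {x, y}). saturated (U - {x, y}) M}"
        using R2[OF y] less.prems by (intro card_mono) (auto simp: perfect_matchings_finite)
      also have "real \<dots> \<le> sqrt (real (card (U - {x, y})) / real (card (H - {x, y})))
          ^ card (U - {x, y}) * real (card (perfect_matchings (H - {x, y})))"
        using less.prems cU \<open>u \<ge> 2\<close> by (intro less.hyps) (auto simp: u_def)
      finally show ?thesis
        using less.prems by (simp add: cU cH B_def card_perfect_matchings)
    qed
    have "card {M \<in> perfect_matchings H. saturated U M} = (\<Sum>y\<in>H - {x}. card (R y))"
      unfolding R_def using less.prems x by (intro card_perfect_matchings_insert) auto
    also have "\<dots> = (\<Sum>y\<in>U - {x}. card (R y))"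
    proof (intro sum.mono_neutral_right ballI)
      show "card (R y) = 0" if "y \<in> H - {x} - (U - {x})" for y
      proof -
        have "y \<in> H - U" using that by auto
        then show ?thesis by (simp only: R1 card.empty)
      qed
    qed (use less.prems in auto)
    also have "real \<dots> \<le> (\<Sum>y\<in>U - {x}. B)"
      unfolding of_nat_sum by (intro sum_mono le)
    also have "\<dots> = real (u - 1) * B" using x finU by (simp add: u_def)
    \<comment> \<open>For \<open>u = 1\<close> the left side is 0: a single point has no partner
      inside \<open>U\<close>.\<close>
    also have "\<dots> \<le> sqrt (real u / real h) ^ u * real (num_matchings h)"
    proof (cases "u = 1")
      case False
      then have u2: "u \<ge> 2" using u1 by simp
      obtain v where v: "u = Suc (Suc v)" using u2 by (metis add_2_eq_Suc le_Suc_ex)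
      obtain k where k: "h = Suc (Suc k)" using u2 uh by (metis add_2_eq_Suc le_Suc_ex le_trans)
      have vk: "v \<le> k" using uh v k by simp
      have "real v / real k \<le> real u / real h"
        using vk by (cases "k = 0") (auto simp: v k divide_simps algebra_simps)
      then have 1: "sqrt (real v / real k) ^ v \<le> sqrt (real u / real h) ^ v"
        by (intro power_mono) auto
      have 2: "real (u - 1) \<le> real u / real h * real (h - 1)"
        using vk by (simp add: v k field_simps)
      have "real (u - 1) * B = real (u - 1) * sqrt (real v / real k) ^ v * real (num_matchings k)"
        by (simp add: B_def v k)
      also have "\<dots> \<le> (real u / real h * real (h - 1)) * sqrt (real u / real h) ^ v * real (num_matchings k)"
        using 1 2 by (intro mult_mono) auto
      also have "\<dots> = sqrt (real u / real h) ^ 2 * sqrt (real u / real h) ^ v * (real (h - 1) * real (num_matchings k))"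
        by simp
      also have "\<dots> = sqrt (real u / real h) ^ u * real (num_matchings h)"
        by (simp add: v k power2_eq_square algebra_simps del: real_sqrt_mult_self)
      finally show ?thesis .
    qed auto
    finally show ?thesis using less.prems by (simp add: u_def h_def card_perfect_matchings)
  qed
qed

section \<open>Expansion of a cycle with a random perfect matching\<close>

lemma sum_power_card_Pow:
  fixes x :: real
  assumes "finite B"
  shows "(\<Sum>A\<in>Pow B. x ^ card A) = (1 + x) ^ card B"
  using assms
proof induction
  case (insert b B)
  have "(\<Sum>A\<in>Pow (insert b B). x ^ card A) =
      (\<Sum>A\<in>Pow B. x ^ card A) + (\<Sum>A\<in>insert b ` Pow B. x ^ card A)"
    unfolding Pow_insert using insert.hyps by (intro sum.union_disjoint) auto
  also have "(\<Sum>A\<in>insert b ` Pow B. x ^ card A) = (\<Sum>A\<in>Pow B. x ^ card (insert b A))"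
    using insert.hyps by (intro sum.reindex_cong[of "insert b"]) (auto simp: inj_on_def)
  also have "\<dots> = (\<Sum>A\<in>Pow B. x * x ^ card A)"
  proof (intro sum.cong refl)
    fix A assume "A \<in> Pow B"
    then have "finite A" "b \<notin> A" using insert.hyps finite_subset by auto
    then show "x ^ card (insert b A) = x * x ^ card A" by simp
  qed
  finally show ?case using insert by (simp add: sum_distrib_left[symmetric] algebra_simps)
qed simp

text \<open>An exponential moment bound: every counted set has weight
  \<open>(1 / x) ^ j * x ^ card A \<ge> 1\<close>, and the weights of all subsets add up to
  \<open>(1 / x) ^ j * (1 + x) ^ card B\<close>. The parameter \<open>x\<close> stays free because
  the union bound uses it with two different values.\<close>

lemma card_small_subsets_le:
  assumes "finite B" "0 < x" "x \<le> 1"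
  shows "real (card {A. A \<subseteq> B \<and> card A \<le> j}) \<le> (1 / x) ^ j * exp (x * real (card B))"
proof -
  have "real (card {A. A \<subseteq> B \<and> card A \<le> j}) = (\<Sum>A\<in>{A. A \<subseteq> B \<and> card A \<le> j}. 1)" by simp
  also have "\<dots> \<le> (\<Sum>A\<in>{A. A \<subseteq> B \<and> card A \<le> j}. (1 / x) ^ j * x ^ card A)"
  proof (intro sum_mono)
    fix A assume "A \<in> {A. A \<subseteq> B \<and> card A \<le> j}"
    then have "x ^ j \<le> x ^ card A" using assms by (intro power_decreasing) auto
    then show "1 \<le> (1 / x) ^ j * x ^ card A" using assms by (simp add: field_simps)
  qed
  also have "\<dots> \<le> (\<Sum>A\<in>Pow B. (1 / x) ^ j * x ^ card A)"
    using assms by (intro sum_mono2) auto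
  also have "\<dots> = (1 / x) ^ j * (1 + x) ^ card B"
    by (simp only: sum_distrib_left[symmetric] sum_power_card_Pow[OF assms(1)])
  also have "(1 + x) ^ card B \<le> exp x ^ card B"
    using assms exp_ge_add_one_self[of x] by (intro power_mono) auto
  also have "exp x ^ card B = exp (x * real (card B))"
    by (simp add: exp_of_nat_mult[symmetric] mult.commute)
  finally show ?thesis using assms by (simp add: mult_left_mono)
qed

text \<open>A cycle edge is encoded by the index from which it leads clockwise, so that a boundary
  is again a subset of \<open>{..<m}\<close> and can be counted as such.\<close>

definition cyclic_boundary :: "nat \<Rightarrow> nat set \<Rightarrow> nat set" where
  "cyclic_boundary m S = {i. i < m \<and> (i \<in> S) \<noteq> (Suc i mod m \<in> S)}"

definition matched_outside :: "(nat \<Rightarrow> 'a) \<Rightarrow> nat \<Rightarrow> 'a set set \<Rightarrow> nat set \<Rightarrow> nat set" where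
  "matched_outside p m M S = {i \<in> S. \<exists>j\<in>{..<m} - S. {p i, p j} \<in> M}"

text \<open>If this fails, at least \<open>card S / 256\<close> edges of one of the two kinds leave
  \<open>S\<close>, which is the cut hypothesis of \<open>cheeger_inequality\<close>.\<close>

definition nonexpanding :: "(nat \<Rightarrow> 'a) \<Rightarrow> nat \<Rightarrow> 'a set set \<Rightarrow> nat set \<Rightarrow> bool" where
  "nonexpanding p m M S \<longleftrightarrow> card (cyclic_boundary m S) \<le> card S div 256 \<and>
     card (matched_outside p m M S) \<le> card S div 256"

text \<open>Walking around the cycle from 0, membership changes exactly at the boundary edges. The
  one bit about 0 is the factor 2 in \<open>card_small_cyclic_boundary_le\<close>.\<close>

lemma cyclic_boundary_inj:
  assumes "S \<subseteq> {..<m}" "S' \<subseteq> {..<m}" "0 \<in> S \<longleftrightarrow> 0 \<in> S'"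
    "cyclic_boundary m S = cyclic_boundary m S'"
  shows "S = S'"
proof -
  have "i \<in> S \<longleftrightarrow> i \<in> S'" if "i < m" for i
    using that
  proof (induction i)
    case (Suc i)
    then have "i \<in> cyclic_boundary m S \<longleftrightarrow> i \<in> cyclic_boundary m S'" using assms(4) by simp
    with Suc show ?case by (auto simp: cyclic_boundary_def)
  qed (use assms(3) in simp)
  then show ?thesis using assms(1,2) by blast
qed

lemma card_small_cyclic_boundary_le:
  "card {S. S \<subseteq> {..<m} \<and> card (cyclic_boundary m S) \<le> j} \<le> 2 * card {A. A \<subseteq> {..<m} \<and> card A \<le> j}"
proof -
  have "card {S. S \<subseteq> {..<m} \<and> card (cyclic_boundary m S) \<le> j} \<le>
      card ((UNIV :: bool set) \<times> {A. A \<subseteq> {..<m} \<and> card A \<le> j})"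
  proof (rule card_inj_on_le)
    show "inj_on (\<lambda>S. (0 \<in> S, cyclic_boundary m S)) {S. S \<subseteq> {..<m} \<and> card (cyclic_boundary m S) \<le> j}"
      by (intro inj_onI, rule cyclic_boundary_inj[of _ m]) auto
    show "(\<lambda>S. (0 \<in> S, cyclic_boundary m S)) ` {S. S \<subseteq> {..<m} \<and> card (cyclic_boundary m S) \<le> j}
        \<subseteq> UNIV \<times> {A. A \<subseteq> {..<m} \<and> card A \<le> j}"
      by (auto simp: cyclic_boundary_def)
  qed simp
  then show ?thesis by (simp add: card_cartesian_product)
qed

text \<open>The partner of a remaining point lies in \<open>S\<close> and has that point as its own
  partner, so it remains as well. A set with few points matched outside thus contains a large
  saturated set, to which \<open>card_saturated_matchings_le\<close> applies.\<close>

lemma saturated_matched_inside: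
  assumes "M \<in> perfect_matchings (p ` {..<m})" "inj_on p {..<m}" "S \<subseteq> {..<m}"
  shows "saturated (p ` (S - matched_outside p m M S)) M"
  unfolding saturated_def
proof (intro ballI disjCI)
  fix e assume e: "e \<in> M" and ne: "e \<inter> p ` (S - matched_outside p m M S) \<noteq> {}"
  have U: "\<Union>M = p ` {..<m}" and dis: "disjoint M" and "card e = 2"
    using assms(1) e by (auto simp: perfect_matchings_def partition_on_def)
  from ne obtain i where i: "i \<in> S" "i \<notin> matched_outside p m M S" "p i \<in> e" by blast
  obtain y where y: "e = {p i, y}" using \<open>card e = 2\<close> i(3) by (auto simp: card_2_iff)
  then obtain j where j: "j < m" "y = p j" using U e by blast
  then have ej: "e = {p i, p j}" using y by simp
  then have "j \<in> S" using i j e by (auto simp: matched_outside_def)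
  have "j \<notin> matched_outside p m M S"
  proof
    assume "j \<in> matched_outside p m M S"
    then obtain l where l: "l < m" "l \<notin> S" "{p j, p l} \<in> M" by (auto simp: matched_outside_def)
    then have "{p j, p l} = e" using disjointD[OF dis e, of "{p j, p l}"] ej by blast
    then have "p l = p i \<or> p l = p j" using ej by (auto simp: doubleton_eq_iff)
    then show False using assms(2,3) i l j \<open>j \<in> S\<close> by (auto dest: inj_onD)
  qed
  then show "e \<subseteq> p ` (S - matched_outside p m M S)"
    using i \<open>j \<in> S\<close> ej by auto
qed

text \<open>
  The constant 256 makes the factor \<open>a ^ (s - 3 * j)\<close> with \<open>a\<^sup>2 \<le> 1 / 2\<close> beat the number
  of choices, up to an exponentially small rest.
\<close>

lemma union_bound_term_le:
  assumes "1 \<le> s" "0 < a" "a\<^sup>2 \<le> 1 / 2"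
  defines "j \<equiv> s div 256"
  shows "(2 * ((256 / a\<^sup>2) ^ j * exp (real s / 256))) * (256 ^ j * exp (real s / 256) * a ^ (s - j))
    \<le> 4 * a * exp (- ln 2 / 4) ^ s"
proof -
  have j: "3 * j + 1 \<le> s" "256 * j \<le> s" using assms(1) by (simp_all add: j_def)
  have js: "real j \<le> real s / 256" using j(2) by linarith
  have "2 * ln a = ln (a\<^sup>2)" using assms(2) by (simp add: ln_realpow)
  also have "\<dots> \<le> ln (1 / 2)" using assms by (subst ln_le_cancel_iff) auto
  also have "\<dots> = - ln 2" by (simp add: ln_div)
  finally have lna: "ln a \<le> - ln 2 / 2" by simp
  have "exp (1::real) \<le> 4" using exp_le by simp
  then have "1 \<le> ln (4::real)" by (subst ln_ge_iff) auto
  then have ln2: "1 \<le> 2 * ln (2::real)" using ln_realpow[of 2 2] by simp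
  \<comment> \<open>The last factor cancels the denominator of \<open>(256 / a\<^sup>2) ^ j\<close>,
    a single \<open>a\<close> is kept for the decay in \<open>m\<close>, and the middle power has to
    beat everything else.\<close>
  have eq: "a ^ (s - j) = a * a ^ (s - 3 * j - 1) * (a\<^sup>2) ^ j"
  proof -
    have "s - j = 1 + (s - 3 * j - 1) + 2 * j" using j(1) by simp
    then show ?thesis by (simp only: power_add power_mult power_one_right)
  qed
  have "(2 * ((256 / a\<^sup>2) ^ j * exp (real s / 256))) * (256 ^ j * exp (real s / 256) * a ^ (s - j)) =
      2 * a * (256 ^ j * 256 ^ j * (exp (real s / 256) * exp (real s / 256)) * a ^ (s - 3 * j - 1))"
    using assms(2) unfolding eq by (simp add: power_divide)
  also have "256 ^ j * 256 ^ j * (exp (real s / 256) * exp (real s / 256)) * a ^ (s - 3 * j - 1) =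
      exp (real j * (16 * ln 2) + real s / 128 + real (s - 3 * j - 1) * ln a)"
  proof -
    have "exp (real j * (16 * ln 2)) = 256 ^ j * 256 ^ j"
    proof -
      have "exp (16 * ln 2) = (256 * 256 :: real)"
        using exp_of_nat_mult[of 16 "ln (2::real)"] by simp
      then show ?thesis by (simp add: exp_of_nat_mult power_mult_distrib[symmetric])
    qed
    moreover have "exp (real (s - 3 * j - 1) * ln a) = a ^ (s - 3 * j - 1)"
      using assms(2) by (simp add: exp_of_nat_mult)
    moreover have "exp (real s / 256) * exp (real s / 256) = exp (real s / 128)"
      by (simp flip: exp_add)
    ultimately show ?thesis by (simp only: exp_add)
  qed
  also have "\<dots> \<le> exp (ln 2 + real s * (- ln 2 / 4))"
  proof -
    have d: "real (s - 3 * j - 1) = real s - 3 * real j - 1" using j(1) by linarith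
    have 1: "real (s - 3 * j - 1) * ln a \<le> (real s - 3 * real j - 1) * (- ln 2 / 2)"
      unfolding d[symmetric] by (intro mult_left_mono lna) auto
    \<comment> \<open>In terms of \<open>y\<close> the quantities to be beaten are at most
      \<open>(16 + 4 + 3 / 2) / 256 * y \<le> y / 4\<close>, so half of the gain
      \<open>y / 2\<close> survives as the factor \<open>exp (- ln 2 / 4) ^ s\<close>.\<close>
    define x y where "x = real j * ln 2" and "y = real s * ln 2"
    have "256 * real j \<le> real s" using js by simp
    then have "256 * real j * ln 2 \<le> real s * ln 2" by (intro mult_right_mono) auto
    then have "256 * x \<le> y" by (simp only: x_def y_def mult.assoc)
    moreover have "real s * 1 \<le> real s * (2 * ln 2)" by (intro mult_left_mono ln2) auto
    then have "real s \<le> 2 * y" by (simp only: y_def mult_ac mult_1)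
    moreover have "0 \<le> y" "(0::real) \<le> ln 2" by (simp_all add: y_def)
    ultimately have "16 * x + real s / 128 + (ln 2 / 2 + 3 * x / 2 - y / 2) \<le> ln 2 - y / 4"
      by linarith
    moreover have "(real s - 3 * real j - 1) * (- ln 2 / 2) = ln 2 / 2 + 3 * x / 2 - y / 2"
      by (simp add: x_def y_def field_simps)
    ultimately show ?thesis using 1 by (simp add: x_def y_def)
  qed
  also have "\<dots> = 2 * exp (- ln 2 / 4) ^ s"
    by (simp only: exp_add exp_of_nat_mult) simp
  finally show ?thesis using assms(2) by (simp add: mult_ac)
qed

text \<open>The terms with small \<open>s\<close> are not exponentially small in \<open>m\<close>.
  The factor \<open>a = sqrt (s / m)\<close> set aside in \<open>union_bound_term_le\<close> gives
  them the decay \<open>1 / sqrt m\<close>, and the geometric factor makes the sum over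
  \<open>s\<close> converge.\<close>

lemma nonexpanding_prob_le:
  fixes p :: "nat \<Rightarrow> 'a"
  assumes inj: "inj_on p {..<m}" and m: "even m" "m > 0"
  shows "measure_pmf.prob (pmf_of_set (perfect_matchings (p ` {..<m})))
      {M. \<exists>S\<subseteq>{..<m}. S \<noteq> {} \<and> 2 * card S \<le> m \<and> nonexpanding p m M S}
    \<le> 4 * (\<Sum>s. real s * exp (- ln 2 / 4) ^ s) / sqrt (real m)"
proof -
  define PM where "PM = perfect_matchings (p ` {..<m})"
  define \<rho> :: real where "\<rho> = exp (- ln 2 / 4)"
  have finPM: "finite PM" by (simp add: PM_def perfect_matchings_finite)
  have cardH: "card (p ` {..<m}) = m" using inj by (simp add: card_image)
  have nePM: "PM \<noteq> {}" unfolding PM_def using m cardH by (intro perfect_matchings_nonempty) auto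
  \<comment> \<open>A bad matching is witnessed by an offending set \<open>S \<in> F s\<close>
    together with some \<open>T \<in> G S\<close>, the candidate for
    \<open>matched_outside p m M S\<close>.\<close>
  define F where "F s = {S. S \<subseteq> {..<m} \<and> card S = s \<and> card (cyclic_boundary m S) \<le> s div 256}" for s
  define G where "G S = {T. T \<subseteq> S \<and> card T \<le> card S div 256}" for S :: "nat set"
  define Z where "Z S T = {M \<in> PM. saturated (p ` (S - T)) M}" for S T
  have finF: "finite (F s)" for s by (rule finite_subset[of _ "Pow {..<m}"]) (auto simp: F_def)
  have finG: "finite (G S)" if "S \<subseteq> {..<m}" for S
    using finite_subset[OF that] by (intro finite_subset[of "G S" "Pow S"]) (auto simp: G_def)
  have finZ: "finite (Z S T)" for S T using finPM by (simp add: Z_def)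
  have Zle: "real (card (Z S T)) \<le> sqrt (real s / real m) ^ (s - s div 256) * real (card PM)"
    if "S \<in> F s" "T \<in> G S" for s S T
  proof -
    have S: "S \<subseteq> {..<m}" "card S = s" "T \<subseteq> S" "card T \<le> s div 256"
      using that by (auto simp: F_def G_def)
    have fin: "finite S" using S(1) finite_subset by blast
    have sm: "s \<le> m" using card_mono[OF _ S(1)] S(2) by simp
    have c: "card (p ` (S - T)) = s - card T"
      using S fin finite_subset[OF S(3)] inj_on_subset[OF inj, of "S - T"]
      by (subst card_image) (auto simp: card_Diff_subset)
    have "real (card (Z S T)) \<le> sqrt (real (s - card T) / real m) ^ (s - card T) * real (card PM)"
      using card_saturated_matchings_le[of "p ` {..<m}" "p ` (S - T)"] S(1)
      unfolding Z_def PM_def c cardH by auto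
    also have "sqrt (real (s - card T) / real m) ^ (s - card T) \<le> sqrt (real s / real m) ^ (s - card T)"
      by (intro power_mono) (auto intro!: divide_right_mono)
    also have "\<dots> \<le> sqrt (real s / real m) ^ (s - s div 256)"
      using S(4) sm m by (intro power_decreasing) auto
    finally show ?thesis by (simp add: mult_right_mono)
  qed
  define B where "B = (\<Union>s\<in>{1..m div 2}. \<Union>S\<in>F s. \<Union>T\<in>G S. Z S T)"
  have bad: "PM \<inter> {M. \<exists>S\<subseteq>{..<m}. S \<noteq> {} \<and> 2 * card S \<le> m \<and> nonexpanding p m M S} \<subseteq> B"
  proof
    fix M assume "M \<in> PM \<inter> {M. \<exists>S\<subseteq>{..<m}. S \<noteq> {} \<and> 2 * card S \<le> m \<and> nonexpanding p m M S}"
    then obtain S where M: "M \<in> PM" and S: "S \<subseteq> {..<m}" "S \<noteq> {}" "2 * card S \<le> m"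
      "nonexpanding p m M S" by blast
    have "finite S" using S(1) finite_subset by blast
    then have "card S \<in> {1..m div 2}" using S by (auto simp: Suc_le_eq card_gt_0_iff)
    moreover have "S \<in> F (card S)" using S by (simp add: F_def nonexpanding_def)
    moreover have "matched_outside p m M S \<in> G S"
      using S by (auto simp: G_def nonexpanding_def matched_outside_def)
    moreover have "M \<in> Z S (matched_outside p m M S)"
      using saturated_matched_inside[of M p m S] M S inj by (simp add: Z_def PM_def)
    ultimately show "M \<in> B" unfolding B_def by blast
  qed
  have "real (card B) \<le> (\<Sum>s\<in>{1..m div 2}. \<Sum>S\<in>F s. \<Sum>T\<in>G S. real (card (Z S T)))"
  proof -
    have "card B \<le> (\<Sum>s\<in>{1..m div 2}. card (\<Union>S\<in>F s. \<Union>T\<in>G S. Z S T))"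
      unfolding B_def by (rule card_UN_le) simp
    also have "\<dots> \<le> (\<Sum>s\<in>{1..m div 2}. \<Sum>S\<in>F s. card (\<Union>T\<in>G S. Z S T))"
      by (intro sum_mono card_UN_le finF)
    also have "\<dots> \<le> (\<Sum>s\<in>{1..m div 2}. \<Sum>S\<in>F s. \<Sum>T\<in>G S. card (Z S T))"
      by (intro sum_mono card_UN_le finG) (auto simp: F_def)
    finally show ?thesis unfolding of_nat_sum[symmetric] by (simp only: of_nat_le_iff)
  qed
  also have "\<dots> \<le> (\<Sum>s\<in>{1..m div 2}. 4 * (real s / sqrt (real m)) * \<rho> ^ s * real (card PM))"
  proof (rule sum_mono)
    fix s assume s: "s \<in> {1..m div 2}"
    define a where "a = sqrt (real s / real m)"
    define j where "j = s div 256"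
    have s1: "1 \<le> s" and sm: "2 * s \<le> m" using s by auto
    have a2: "a\<^sup>2 = real s / real m" by (simp add: a_def)
    have a: "0 < a" "a\<^sup>2 \<le> 1 / 2" using s1 sm m by (simp_all add: a_def field_simps)
    have cF: "real (card (F s)) \<le> 2 * ((256 / a\<^sup>2) ^ j * exp (real s / 256))"
    proof -
      have "card (F s) \<le> card {S. S \<subseteq> {..<m} \<and> card (cyclic_boundary m S) \<le> j}"
        by (intro card_mono) (auto simp: F_def j_def)
      also have "\<dots> \<le> 2 * card {A. A \<subseteq> {..<m} \<and> card A \<le> j}"
        by (rule card_small_cyclic_boundary_le)
      \<comment> \<open>The weight \<open>a\<^sup>2 / 256 = s / (256 * m)\<close> is tuned to make
        the exponential factor \<open>exp (s / 256)\<close>, independent of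
        \<open>m\<close>.\<close>
      also have "real \<dots> \<le> 2 * ((1 / (a\<^sup>2 / 256)) ^ j * exp (a\<^sup>2 / 256 * real (card {..<m})))"
        using card_small_subsets_le[of "{..<m}" "a\<^sup>2 / 256" j] a by simp
      also have "a\<^sup>2 / 256 * real (card {..<m}) = real s / 256" using m by (simp add: a2)
      finally show ?thesis by simp
    qed
    have cG: "real (card (G S)) \<le> 256 ^ j * exp (real s / 256)" if "S \<in> F s" for S
    proof -
      have "finite S" "card S = s" using that finite_subset by (auto simp: F_def)
      then show ?thesis using card_small_subsets_le[of S "1 / 256" j] by (simp add: G_def j_def)
    qed
    have "(\<Sum>S\<in>F s. \<Sum>T\<in>G S. real (card (Z S T))) \<le> (\<Sum>S\<in>F s. \<Sum>T\<in>G S. a ^ (s - j) * real (card PM))"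
      unfolding a_def j_def by (intro sum_mono Zle)
    also have "\<dots> = (\<Sum>S\<in>F s. real (card (G S)) * (a ^ (s - j) * real (card PM)))" by simp
    also have "\<dots> \<le> (\<Sum>S\<in>F s. 256 ^ j * exp (real s / 256) * (a ^ (s - j) * real (card PM)))"
      using a by (intro sum_mono mult_right_mono cG) auto
    also have "\<dots> = real (card (F s)) * (256 ^ j * exp (real s / 256) * (a ^ (s - j) * real (card PM)))"
      by simp
    also have "\<dots> \<le> 2 * ((256 / a\<^sup>2) ^ j * exp (real s / 256)) *
        (256 ^ j * exp (real s / 256) * (a ^ (s - j) * real (card PM)))"
      using a by (intro mult_right_mono cF) auto
    also have "\<dots> = 2 * ((256 / a\<^sup>2) ^ j * exp (real s / 256)) *
        (256 ^ j * exp (real s / 256) * a ^ (s - j)) * real (card PM)"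
      by (simp only: mult.assoc)
    also have "\<dots> \<le> 4 * a * \<rho> ^ s * real (card PM)"
      unfolding j_def \<rho>_def using s1 a by (intro mult_right_mono union_bound_term_le) auto
    also have "a \<le> real s / sqrt (real m)"
    proof -
      have "sqrt (real s) \<le> real s"
        using s1 by (intro real_le_lsqrt) (auto simp: power2_eq_square)
      then show ?thesis unfolding a_def real_sqrt_divide by (intro divide_right_mono) auto
    qed
    finally show "(\<Sum>S\<in>F s. \<Sum>T\<in>G S. real (card (Z S T)))
        \<le> 4 * (real s / sqrt (real m)) * \<rho> ^ s * real (card PM)"
      by (simp add: mult_right_mono \<rho>_def)
  qed
  also have "\<dots> = (\<Sum>s\<in>{1..m div 2}. real s * \<rho> ^ s) * (4 / sqrt (real m) * real (card PM))"
    unfolding sum_distrib_right by (intro sum.cong refl) simp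
  also have "\<dots> \<le> (\<Sum>s. real s * \<rho> ^ s) * (4 / sqrt (real m) * real (card PM))"
  proof (intro mult_right_mono sum_le_suminf)
    have "\<bar>\<rho>\<bar> < 1" by (simp add: \<rho>_def)
    then show "summable (\<lambda>s. real s * \<rho> ^ s)"
      using summable_mult[OF geometric_deriv_sums[THEN sums_summable, of \<rho>], of \<rho>]
      by (subst summable_Suc_iff[symmetric]) (simp add: mult_ac)
  qed (auto simp: \<rho>_def)
  finally have cardB: "real (card B) \<le> (\<Sum>s. real s * \<rho> ^ s) * (4 / sqrt (real m) * real (card PM))" .
  have "measure_pmf.prob (pmf_of_set PM)
      {M. \<exists>S\<subseteq>{..<m}. S \<noteq> {} \<and> 2 * card S \<le> m \<and> nonexpanding p m M S} =
      real (card (PM \<inter> {M. \<exists>S\<subseteq>{..<m}. S \<noteq> {} \<and> 2 * card S \<le> m \<and> nonexpanding p m M S})) / real (card PM)"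
    using nePM finPM by (simp add: measure_pmf_of_set)
  also have "\<dots> \<le> real (card B) / real (card PM)"
    using bad finF finG finZ by (intro divide_right_mono) (auto simp: B_def F_def intro!: card_mono)
  also have "\<dots> \<le> 4 * (\<Sum>s. real s * \<rho> ^ s) / sqrt (real m)"
    using cardB nePM finPM by (simp add: field_simps card_gt_0_iff)
  finally show ?thesis by (simp add: PM_def \<rho>_def)
qed

section \<open>Cheeger's inequality\<close>

text \<open>Layer by layer: removing the lowest positive level \<open>t\<close> of \<open>u\<close>
  lowers the right side by \<open>t\<close> times the cut of the support \<open>S\<close>, once for
  each order of a pair, whence the factor 2. The supports shrink in the induction, so all of them
  satisfy the size condition of \<open>cut\<close>.\<close>

lemma coarea_inequality:
  fixes w :: "'a \<Rightarrow> 'a \<Rightarrow> real" and \<delta> :: real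
  assumes fin: "finite X" and sym: "\<And>x y. w x y = w y x"
    and cut: "\<And>S. S \<subseteq> X \<Longrightarrow> 2 * card S \<le> card X \<Longrightarrow> \<delta> * card S \<le> (\<Sum>x\<in>S. \<Sum>y\<in>X - S. w x y)"
    and u: "\<And>x. u x \<ge> 0" "2 * card {x \<in> X. u x > 0} \<le> card X"
  shows "2 * \<delta> * (\<Sum>x\<in>X. u x) \<le> (\<Sum>x\<in>X. \<Sum>y\<in>X. w x y * \<bar>u x - u y\<bar>)"
  using u
proof (induction "card {x \<in> X. u x > 0}" arbitrary: u rule: less_induct)
  case less
  define S where "S = {x \<in> X. u x > 0}"
  have S: "S \<subseteq> X" "finite S" using fin by (auto simp: S_def)
  have u0: "u x = 0" if "x \<in> X" "x \<notin> S" for x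
    using that less.prems(1)[of x] by (auto simp: S_def)
  show ?case
  proof (cases "S = {}")
    case True
    with u0 show ?thesis by simp
  next
    case False
    define t where "t = Min (u ` S)"
    have t: "t \<in> u ` S" "\<And>x. x \<in> S \<Longrightarrow> t \<le> u x"
      using S False by (auto simp: t_def)
    then have tpos: "t > 0" by (auto simp: S_def)
    define u' where "u' x = (if x \<in> S then u x - t else 0)" for x
    from t(1) obtain x0 where x0: "x0 \<in> S" "u x0 = t" by blast
    have sub: "{x \<in> X. u' x > 0} \<subset> S"
    proof
      show "{x \<in> X. u' x > 0} \<subseteq> S" by (auto simp: u'_def split: if_splits)
      show "{x \<in> X. u' x > 0} \<noteq> S" using x0 by (auto simp: u'_def S_def)
    qed
    have lt: "card {x \<in> X. u' x > 0} < card {x \<in> X. u x > 0}"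
      using psubset_card_mono[OF S(2) sub] by (simp add: S_def)
    have IH: "2 * \<delta> * (\<Sum>x\<in>X. u' x) \<le> (\<Sum>x\<in>X. \<Sum>y\<in>X. w x y * \<bar>u' x - u' y\<bar>)"
      using lt less.prems t(2) by (intro less.hyps) (auto simp: u'_def)
    have u_eq: "u x = u' x + (if x \<in> S then t else 0)" if "x \<in> X" for x
      using u0 that by (auto simp: u'_def)
    have sum_u: "(\<Sum>x\<in>X. u x) = (\<Sum>x\<in>X. u' x) + t * card S"
    proof -
      have "(\<Sum>x\<in>X. u x) = (\<Sum>x\<in>X. u' x + (if x \<in> S then t else 0))"
        by (intro sum.cong refl u_eq)
      also have "\<dots> = (\<Sum>x\<in>X. u' x) + t * card S"
        using S fin by (simp add: sum.distrib sum.If_cases Int_absorb1)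
      finally show ?thesis .
    qed
    \<comment> \<open>As \<open>t\<close> is the least value on \<open>S\<close>, lowering by
      \<open>t\<close> changes no sign: pairs within \<open>S\<close> keep their difference and
      pairs across lose exactly \<open>t\<close>.\<close>
    have diff: "\<bar>u x - u y\<bar> = \<bar>u' x - u' y\<bar> + t * (of_bool (x \<in> S \<and> y \<notin> S) + of_bool (y \<in> S \<and> x \<notin> S))"
      if "x \<in> X" "y \<in> X" for x y
      using u0[of x] u0[of y] t(2)[of x] t(2)[of y] that tpos by (auto simp: u'_def)
    define c where "c = (\<Sum>x\<in>S. \<Sum>y\<in>X - S. w x y)"
    have c1: "(\<Sum>x\<in>X. \<Sum>y\<in>X. w x y * of_bool (x \<in> S \<and> y \<notin> S)) = c"
    proof -
      have "(\<Sum>x\<in>X. \<Sum>y\<in>X. w x y * of_bool (x \<in> S \<and> y \<notin> S)) =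
          (\<Sum>x\<in>S. \<Sum>y\<in>X. w x y * of_bool (x \<in> S \<and> y \<notin> S))"
        using S fin by (intro sum.mono_neutral_right) auto
      also have "\<dots> = c"
        unfolding c_def using S fin by (intro sum.cong refl sum.mono_neutral_cong_right) auto
      finally show ?thesis .
    qed
    have c2: "(\<Sum>x\<in>X. \<Sum>y\<in>X. w x y * of_bool (y \<in> S \<and> x \<notin> S)) = c"
      by (subst sum.swap) (simp add: sym c1)
    have "(\<Sum>x\<in>X. \<Sum>y\<in>X. w x y * \<bar>u x - u y\<bar>) =
        (\<Sum>x\<in>X. \<Sum>y\<in>X. w x y * \<bar>u' x - u' y\<bar> + t * (w x y * of_bool (x \<in> S \<and> y \<notin> S))
          + t * (w x y * of_bool (y \<in> S \<and> x \<notin> S)))"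
      by (intro sum.cong refl) (simp add: diff algebra_simps)
    also have "\<dots> = (\<Sum>x\<in>X. \<Sum>y\<in>X. w x y * \<bar>u' x - u' y\<bar>) + t * c + t * c"
      unfolding sum.distrib c1[symmetric] c2[symmetric] sum_distrib_left[symmetric]
      by (simp add: c1 c2)
    finally have eq: "(\<Sum>x\<in>X. \<Sum>y\<in>X. w x y * \<bar>u x - u y\<bar>) =
      (\<Sum>x\<in>X. \<Sum>y\<in>X. w x y * \<bar>u' x - u' y\<bar>) + 2 * (t * c)" by simp
    have "t * (\<delta> * card S) \<le> t * c"
      unfolding c_def using S less.prems(2) tpos by (intro mult_left_mono cut) (auto simp: S_def)
    then show ?thesis using IH unfolding eq sum_u by (simp add: algebra_simps)
  qed
qed

text \<open>The coarea inequality for the squares of \<open>g\<close>, where each difference of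
  squares is factored and Cauchy-Schwarz separates the factors. The sums \<open>g x + g y\<close>
  contribute at most \<open>4 * \<Delta> * N\<close>, so one factor \<open>N\<close> cancels at the
  end.\<close>

lemma cheeger_nonneg:
  fixes w :: "'a \<Rightarrow> 'a \<Rightarrow> real" and \<delta> :: real
  assumes fin: "finite X" and sym: "\<And>x y. w x y = w y x" and nonneg: "\<And>x y. w x y \<ge> 0"
    and deg: "\<And>x. x \<in> X \<Longrightarrow> (\<Sum>y\<in>X. w x y) \<le> \<Delta>"
    and \<delta>: "\<delta> > 0"
    and cut: "\<And>S. S \<subseteq> X \<Longrightarrow> 2 * card S \<le> card X \<Longrightarrow> \<delta> * card S \<le> (\<Sum>x\<in>S. \<Sum>y\<in>X - S. w x y)"
    and g: "\<And>x. g x \<ge> 0" "2 * card {x \<in> X. g x > 0} \<le> card X"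
  shows "\<delta>\<^sup>2 * (\<Sum>x\<in>X. (g x)\<^sup>2) \<le> \<Delta> * (\<Sum>x\<in>X. \<Sum>y\<in>X. w x y * (g x - g y)\<^sup>2)"
proof -
  define N where "N = (\<Sum>x\<in>X. (g x)\<^sup>2)"
  define E where "E = (\<Sum>x\<in>X. \<Sum>y\<in>X. w x y * (g x - g y)\<^sup>2)"
  define F where "F = (\<Sum>x\<in>X. \<Sum>y\<in>X. w x y * (g x + g y)\<^sup>2)"
  have N0: "N \<ge> 0" and E0: "E \<ge> 0" by (auto simp: N_def E_def nonneg intro!: sum_nonneg)
  have "{x \<in> X. (g x)\<^sup>2 > 0} = {x \<in> X. g x > 0}"
    using g(1) by (auto simp: less_le)
  then have "2 * \<delta> * N \<le> (\<Sum>x\<in>X. \<Sum>y\<in>X. w x y * \<bar>(g x)\<^sup>2 - (g y)\<^sup>2\<bar>)"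
    unfolding N_def using g by (intro coarea_inequality[OF fin sym cut]) auto
  also have "\<dots> = (\<Sum>(x, y)\<in>X \<times> X. (sqrt (w x y) * \<bar>g x - g y\<bar>) * (sqrt (w x y) * (g x + g y)))"
    unfolding sum.cartesian_product
  proof (intro sum.cong refl, clarify)
    fix x y
    have "\<bar>(g x)\<^sup>2 - (g y)\<^sup>2\<bar> = \<bar>g x - g y\<bar> * (g x + g y)"
      using g(1)[of x] g(1)[of y]
      by (simp add: power2_eq_square square_diff_square_factored abs_mult mult.commute)
    moreover have "w x y = sqrt (w x y) * sqrt (w x y)" using nonneg[of x y] by simp
    ultimately show "w x y * \<bar>(g x)\<^sup>2 - (g y)\<^sup>2\<bar> =
        sqrt (w x y) * \<bar>g x - g y\<bar> * (sqrt (w x y) * (g x + g y))"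
      by (metis mult.assoc mult.left_commute)
  qed
  finally have "(2 * \<delta> * N)\<^sup>2 \<le>
      (\<Sum>(x, y)\<in>X \<times> X. (sqrt (w x y) * \<bar>g x - g y\<bar>) * (sqrt (w x y) * (g x + g y)))\<^sup>2"
    using N0 \<delta> by (intro power_mono) auto
  also have "\<dots> \<le> (\<Sum>(x, y)\<in>X \<times> X. (sqrt (w x y) * \<bar>g x - g y\<bar>)\<^sup>2) *
      (\<Sum>(x, y)\<in>X \<times> X. (sqrt (w x y) * (g x + g y))\<^sup>2)"
    unfolding case_prod_unfold by (rule Cauchy_Schwarz_ineq_sum)
  also have "\<dots> = E * F"
    unfolding E_def F_def sum.cartesian_product by (simp add: power_mult_distrib nonneg)
  also have "\<dots> \<le> E * (4 * \<Delta> * N)"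
  proof (intro mult_left_mono E0)
    have d: "(\<Sum>x\<in>X. \<Sum>y\<in>X. w x y * (g x)\<^sup>2) \<le> \<Delta> * N"
    proof -
      have "(\<Sum>x\<in>X. \<Sum>y\<in>X. w x y * (g x)\<^sup>2) = (\<Sum>x\<in>X. (\<Sum>y\<in>X. w x y) * (g x)\<^sup>2)"
        by (simp add: sum_distrib_right)
      also have "\<dots> \<le> (\<Sum>x\<in>X. \<Delta> * (g x)\<^sup>2)"
        by (intro sum_mono mult_right_mono deg) auto
      finally show ?thesis by (simp add: N_def sum_distrib_left)
    qed
    have d': "(\<Sum>x\<in>X. \<Sum>y\<in>X. w x y * (g y)\<^sup>2) \<le> \<Delta> * N"
      using d by (subst sum.swap) (simp add: sym)
    have sq: "(a + b)\<^sup>2 \<le> 2 * a\<^sup>2 + 2 * b\<^sup>2" for a b :: real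
      using zero_le_power2[of "a - b"] by (simp add: power2_sum power2_diff)
    have "F \<le> (\<Sum>x\<in>X. \<Sum>y\<in>X. w x y * (2 * (g x)\<^sup>2 + 2 * (g y)\<^sup>2))"
      unfolding F_def by (intro sum_mono mult_left_mono sq nonneg)
    also have "\<dots> = 2 * (\<Sum>x\<in>X. \<Sum>y\<in>X. w x y * (g x)\<^sup>2) + 2 * (\<Sum>x\<in>X. \<Sum>y\<in>X. w x y * (g y)\<^sup>2)"
      by (simp add: sum.distrib sum_distrib_left algebra_simps)
    finally show "F \<le> 4 * \<Delta> * N" using d d' by simp
  qed
  finally have "4 * (\<delta>\<^sup>2 * N) * N \<le> 4 * (\<Delta> * E) * N" by (simp add: power2_eq_square algebra_simps)
  show ?thesis
  proof (cases "N = 0")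
    case True
    moreover have "0 \<le> \<Delta> * E"
    proof (cases "X = {}")
      case False
      then obtain x where "x \<in> X" by blast
      then have "0 \<le> \<Delta>" using deg[of x] sum_nonneg[of X "w x"] nonneg by fastforce
      then show ?thesis using E0 by simp
    qed (simp add: E_def)
    ultimately show ?thesis by (simp add: N_def E_def)
  next
    case False
    then show ?thesis using \<open>4 * (\<delta>\<^sup>2 * N) * N \<le> 4 * (\<Delta> * E) * N\<close> N0
      by (simp add: N_def E_def less_le)
  qed
qed

text \<open>Take the least value \<open>c\<close> of \<open>f\<close> with at most half of the
  points above it. The next smaller value has more than half of the points above it, and none of
  those lies below \<open>c\<close>.\<close>

lemma median_exists:
  fixes f :: "'a \<Rightarrow> real"
  assumes "finite X"
  shows "\<exists>c. 2 * card {x \<in> X. f x > c} \<le> card X \<and> 2 * card {x \<in> X. f x < c} \<le> card X"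
proof (cases "X = {}")
  case False
  define A where "A = {v \<in> f ` X. 2 * card {x \<in> X. f x > v} \<le> card X}"
  have "{x \<in> X. f x > Max (f ` X)} = {}"
    using assms Max_ge[of "f ` X"] by (force simp: not_less)
  then have le0: "2 * card {x \<in> X. f x > Max (f ` X)} \<le> card X"
    by (metis card.empty mult_0_right zero_le)
  have ne: "Max (f ` X) \<in> A"
    unfolding A_def using assms False by (intro CollectI conjI Max_in le0) auto
  define c where "c = Min A"
  have finA: "finite A" using assms by (simp add: A_def)
  have cA: "c \<in> A" using finA ne by (auto simp: c_def intro: Min_in)
  have "2 * card {x \<in> X. f x < c} \<le> card X"
  proof (cases "{x \<in> X. f x < c} = {}")
    case ne': False
    define c' where "c' = Max (f ` {x \<in> X. f x < c})"
    have fin': "finite (f ` {x \<in> X. f x < c})" using assms by simp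
    have c': "c' \<in> f ` {x \<in> X. f x < c}" using fin' ne' unfolding c'_def by (intro Max_in) auto
    have "c' \<notin> A" using c' Min_le[OF finA, of c'] by (auto simp: c_def)
    then have "2 * card {x \<in> X. f x > c'} > card X" using c' by (auto simp: A_def)
    moreover have "f x \<le> c'" if "x \<in> X" "f x < c" for x
      using that fin' unfolding c'_def by (intro Max_ge) auto
    then have "{x \<in> X. f x > c'} \<subseteq> X - {x \<in> X. f x < c}" by (auto simp: not_less not_le dest: leD)
    then have "card {x \<in> X. f x > c'} \<le> card X - card {x \<in> X. f x < c}"
      using card_mono[of "X - {x \<in> X. f x < c}" "{x \<in> X. f x > c'}"] assms
      by (simp add: card_Diff_subset)
    ultimately show ?thesis by linarith
  next
    case True
    show ?thesis unfolding True by simp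
  qed
  with cA show ?thesis by (auto simp: A_def)
qed simp

text \<open>Centring at a median gives the positive and the negative part supports of at most half
  the size, as \<open>cheeger_nonneg\<close> demands. A constant other than the mean does no harm,
  since the mean minimises the left side.\<close>

theorem cheeger_inequality:
  fixes w :: "'a \<Rightarrow> 'a \<Rightarrow> real" and \<delta> :: real
  assumes fin: "finite X" and sym: "\<And>x y. w x y = w y x" and nonneg: "\<And>x y. w x y \<ge> 0"
    and deg: "\<And>x. x \<in> X \<Longrightarrow> (\<Sum>y\<in>X. w x y) \<le> \<Delta>" and \<Delta>: "\<Delta> \<ge> 0"
    and \<delta>: "\<delta> > 0"
    and cut: "\<And>S. S \<subseteq> X \<Longrightarrow> 2 * card S \<le> card X \<Longrightarrow> \<delta> * card S \<le> (\<Sum>x\<in>S. \<Sum>y\<in>X - S. w x y)"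
  shows "\<exists>c. \<delta>\<^sup>2 * (\<Sum>x\<in>X. (f x - c)\<^sup>2) \<le> \<Delta> * (\<Sum>x\<in>X. \<Sum>y\<in>X. w x y * (f x - f y)\<^sup>2)"
proof -
  obtain c where c: "2 * card {x \<in> X. f x > c} \<le> card X" "2 * card {x \<in> X. f x < c} \<le> card X"
    using median_exists[OF fin] by blast
  define p q where "p x = max 0 (f x - c)" and "q x = max 0 (c - f x)" for x
  have "{x \<in> X. p x > 0} = {x \<in> X. f x > c}" "{x \<in> X. q x > 0} = {x \<in> X. f x < c}"
    by (auto simp: p_def q_def)
  with c have p: "\<delta>\<^sup>2 * (\<Sum>x\<in>X. (p x)\<^sup>2) \<le> \<Delta> * (\<Sum>x\<in>X. \<Sum>y\<in>X. w x y * (p x - p y)\<^sup>2)"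
    and q: "\<delta>\<^sup>2 * (\<Sum>x\<in>X. (q x)\<^sup>2) \<le> \<Delta> * (\<Sum>x\<in>X. \<Sum>y\<in>X. w x y * (q x - q y)\<^sup>2)"
    by (intro cheeger_nonneg[OF fin sym nonneg deg \<delta> cut]; simp add: p_def q_def)+
  have "(f x - c)\<^sup>2 = (p x)\<^sup>2 + (q x)\<^sup>2" for x
    by (auto simp: p_def q_def max_def power2_commute)
  then have "\<delta>\<^sup>2 * (\<Sum>x\<in>X. (f x - c)\<^sup>2) = \<delta>\<^sup>2 * (\<Sum>x\<in>X. (p x)\<^sup>2) + \<delta>\<^sup>2 * (\<Sum>x\<in>X. (q x)\<^sup>2)"
    by (simp add: sum.distrib algebra_simps)
  also have "\<dots> \<le> \<Delta> * (\<Sum>x\<in>X. \<Sum>y\<in>X. w x y * ((p x - p y)\<^sup>2 + (q x - q y)\<^sup>2))"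
    using add_mono[OF p q] by (simp add: sum.distrib algebra_simps)
  also have "\<dots> \<le> \<Delta> * (\<Sum>x\<in>X. \<Sum>y\<in>X. w x y * (f x - f y)\<^sup>2)"
  proof (intro mult_left_mono sum_mono nonneg \<Delta>)
    fix x y
    \<comment> \<open>Since \<open>p\<close> grows and \<open>q\<close> falls with \<open>f\<close>,
      their increments have opposite signs and the cross term has the favourable sign.\<close>
    have "(p x - p y) * (q x - q y) \<le> 0"
      by (auto simp: p_def q_def max_def mult_le_0_iff zero_le_mult_iff)
    moreover have "f x - f y = (p x - p y) - (q x - q y)"
      by (auto simp: p_def q_def max_def)
    ultimately show "(p x - p y)\<^sup>2 + (q x - q y)\<^sup>2 \<le> (f x - f y)\<^sup>2"
      using power2_diff[of "p x - p y" "q x - q y"] by (simp only: mult.assoc)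
  qed
  finally show ?thesis by blast
qed

section \<open>Mixing of lazy doubly stochastic chains\<close>

lemma dist_step_cong:
  "(\<And>x. x \<in> X \<Longrightarrow> \<mu> x = \<nu> x) \<Longrightarrow> dist_step X P \<mu> y = dist_step X P \<nu> y"
  by (simp add: dist_step_def)

lemma dist_step_diff:
  "dist_step X P (\<lambda>x. \<mu> x - \<nu> x) y = dist_step X P \<mu> y - dist_step X P \<nu> y"
  by (simp add: dist_step_def sum_subtractf algebra_simps)

lemma sum_pmf_distributions_on:
  "finite X \<Longrightarrow> \<sigma> \<in> distributions_on X \<Longrightarrow> (\<Sum>x\<in>X. pmf \<sigma> x) = 1"
  by (simp add: distributions_on_def sum_pmf_eq_1)

lemma tv_norm_le_l2:
  assumes "finite X"
  shows "tv_norm X \<mu> \<nu> \<le> sqrt (real (card X) * (\<Sum>x\<in>X. (\<mu> x - \<nu> x)\<^sup>2))"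
proof -
  have "\<bar>sum \<mu> A - sum \<nu> A\<bar> \<le> sqrt (real (card X) * (\<Sum>x\<in>X. (\<mu> x - \<nu> x)\<^sup>2))" if "A \<subseteq> X" for A
  proof -
    have "\<bar>sum \<mu> A - sum \<nu> A\<bar> = \<bar>\<Sum>x\<in>A. \<mu> x - \<nu> x\<bar>" by (simp add: sum_subtractf)
    also have "\<dots> \<le> (\<Sum>x\<in>A. \<bar>\<mu> x - \<nu> x\<bar>)" by (rule sum_abs)
    also have "\<dots> \<le> (\<Sum>x\<in>X. \<bar>\<mu> x - \<nu> x\<bar>)" using assms that by (intro sum_mono2) auto
    also have "\<dots> \<le> sqrt (real (card X) * (\<Sum>x\<in>X. (\<mu> x - \<nu> x)\<^sup>2))"
      using Cauchy_Schwarz_ineq_sum[of "\<lambda>_. 1" "\<lambda>x. \<bar>\<mu> x - \<nu> x\<bar>" X]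
      by (intro real_le_rsqrt) simp
    finally show ?thesis .
  qed
  then show ?thesis unfolding tv_norm_def using assms by (subst Max_le_iff) auto
qed

lemma tv_norm_ge:
  "finite X \<Longrightarrow> A \<subseteq> X \<Longrightarrow> \<bar>sum \<mu> A - sum \<nu> A\<bar> \<le> tv_norm X \<mu> \<nu>"
  unfolding tv_norm_def by (intro Max_ge) auto

locale doubly_stochastic_chain =
  fixes X :: "'a set" and P :: "'a \<Rightarrow> 'a \<Rightarrow> real"
  assumes finite_states: "finite X" and states_nonempty: "X \<noteq> {}"
    and nonneg: "x \<in> X \<Longrightarrow> y \<in> X \<Longrightarrow> P x y \<ge> 0"
    and row_sum: "x \<in> X \<Longrightarrow> (\<Sum>y\<in>X. P x y) = 1"
    and col_sum: "y \<in> X \<Longrightarrow> (\<Sum>x\<in>X. P x y) = 1"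
begin

lemma sum_dist_step: "(\<Sum>y\<in>X. dist_step X P \<mu> y) = (\<Sum>x\<in>X. \<mu> x)"
proof -
  have "(\<Sum>y\<in>X. dist_step X P \<mu> y) = (\<Sum>x\<in>X. \<Sum>y\<in>X. \<mu> x * P x y)"
    unfolding dist_step_def by (rule sum.swap)
  also have "\<dots> = (\<Sum>x\<in>X. \<mu> x)" by (simp add: sum_distrib_left[symmetric] row_sum)
  finally show ?thesis .
qed

lemma sum_dist_step_funpow: "(\<Sum>y\<in>X. (dist_step X P ^^ k) \<mu> y) = (\<Sum>x\<in>X. \<mu> x)"
  by (induction k) (simp_all add: sum_dist_step)

lemma dist_step_const: "y \<in> X \<Longrightarrow> dist_step X P (\<lambda>_. c) y = c"
  by (simp add: dist_step_def sum_distrib_left[symmetric] col_sum)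

lemma is_stationary_uniform: "is_stationary X P (pmf_of_set X)"
proof -
  have "dist_step X P (pmf (pmf_of_set X)) y = dist_step X P (\<lambda>_. 1 / real (card X)) y" for y
    using finite_states states_nonempty by (intro dist_step_cong) simp
  then show ?thesis
    using finite_states states_nonempty
    by (simp add: is_stationary_def distributions_on_def dist_step_const)
qed

end

locale lazy_doubly_stochastic_chain = doubly_stochastic_chain +
  assumes lazy: "x \<in> X \<Longrightarrow> P x x \<ge> 1 / 2"
begin

text \<open>By the column sums each new value is a weighted mean of \<open>v\<close>, so squaring
  loses exactly the variance \<open>V - b\<^sup>2\<close>. The diagonal contributes nothing to
  \<open>b\<close>, and Cauchy-Schwarz with off-diagonal weight at most 1/2 gives
  \<open>b\<^sup>2 \<le> V / 2\<close>. Nothing here compares \<open>P\<close> with its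
  transpose.\<close>

lemma dist_step_l2_contraction:
  "(\<Sum>y\<in>X. (dist_step X P v y)\<^sup>2) \<le>
     (\<Sum>x\<in>X. (v x)\<^sup>2) - 1 / 2 * (\<Sum>x\<in>X. \<Sum>y\<in>X. P x y * (v x - v y)\<^sup>2)"
proof -
  have "(dist_step X P v y)\<^sup>2 \<le> (\<Sum>x\<in>X. P x y * (v x)\<^sup>2) - 1 / 2 * (\<Sum>x\<in>X. P x y * (v x - v y)\<^sup>2)"
    if y: "y \<in> X" for y
  proof -
    define b where "b = (\<Sum>x\<in>X. P x y * (v x - v y))"
    define V where "V = (\<Sum>x\<in>X. P x y * (v x - v y)\<^sup>2)"
    have V0: "V \<ge> 0" unfolding V_def using y by (auto intro!: sum_nonneg mult_nonneg_nonneg nonneg)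
    have col: "v y * (\<Sum>x\<in>X. P x y) = v y" "(v y)\<^sup>2 * (\<Sum>x\<in>X. P x y) = (v y)\<^sup>2"
      using y by (simp_all add: col_sum)
    have ab: "dist_step X P v y = v y + b"
      using col(1) by (simp add: dist_step_def b_def sum_subtractf sum_distrib_left algebra_simps)
    have sq: "(\<Sum>x\<in>X. P x y * (v x)\<^sup>2) = (v y)\<^sup>2 + 2 * v y * b + V"
    proof -
      have "P x y * (v x)\<^sup>2 =
          (v y)\<^sup>2 * P x y + 2 * v y * (P x y * (v x - v y)) + P x y * (v x - v y)\<^sup>2" for x
        by (simp add: power2_eq_square algebra_simps)
      then have "(\<Sum>x\<in>X. P x y * (v x)\<^sup>2) =
          (v y)\<^sup>2 * (\<Sum>x\<in>X. P x y) + 2 * v y * b + V"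
        by (simp only: b_def V_def sum.distrib sum_distrib_left)
      then show ?thesis by (simp only: col(2))
    qed
    have rest: "(\<Sum>x\<in>X - {y}. P x y) \<le> 1 / 2"
      using col_sum[OF y] lazy[OF y] finite_states y by (simp add: sum_diff1)
    have "b\<^sup>2 = (\<Sum>x\<in>X - {y}. sqrt (P x y) * (sqrt (P x y) * (v x - v y)))\<^sup>2"
    proof -
      have "b = (\<Sum>x\<in>X - {y}. P x y * (v x - v y))"
        unfolding b_def using finite_states by (intro sum.mono_neutral_right) auto
      also have "\<dots> = (\<Sum>x\<in>X - {y}. sqrt (P x y) * (sqrt (P x y) * (v x - v y)))"
        using y by (intro sum.cong refl) (simp add: nonneg flip: mult.assoc)
      finally show ?thesis by simp
    qed
    also have "\<dots> \<le> (\<Sum>x\<in>X - {y}. (sqrt (P x y))\<^sup>2) * (\<Sum>x\<in>X - {y}. (sqrt (P x y) * (v x - v y))\<^sup>2)"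
      by (rule Cauchy_Schwarz_ineq_sum)
    also have "\<dots> = (\<Sum>x\<in>X - {y}. P x y) * (\<Sum>x\<in>X - {y}. P x y * (v x - v y)\<^sup>2)"
      using y by (simp add: power_mult_distrib nonneg)
    also have "(\<Sum>x\<in>X - {y}. P x y * (v x - v y)\<^sup>2) = V"
      unfolding V_def using finite_states by (intro sum.mono_neutral_left) auto
    also have "(\<Sum>x\<in>X - {y}. P x y) * V \<le> 1 / 2 * V" by (intro mult_right_mono rest V0)
    finally have "b\<^sup>2 \<le> 1 / 2 * V" .
    moreover have "(v y + b)\<^sup>2 = (v y)\<^sup>2 + 2 * v y * b + b\<^sup>2" by (simp add: power2_sum)
    ultimately show ?thesis unfolding ab sq V_def[symmetric] by simp
  qed
  then have "(\<Sum>y\<in>X. (dist_step X P v y)\<^sup>2) \<le>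
      (\<Sum>y\<in>X. (\<Sum>x\<in>X. P x y * (v x)\<^sup>2) - 1 / 2 * (\<Sum>x\<in>X. P x y * (v x - v y)\<^sup>2))"
    by (rule sum_mono)
  also have "\<dots> = (\<Sum>y\<in>X. \<Sum>x\<in>X. P x y * (v x)\<^sup>2) - 1 / 2 * (\<Sum>y\<in>X. \<Sum>x\<in>X. P x y * (v x - v y)\<^sup>2)"
    by (simp only: sum_subtractf sum_distrib_left)
  also have "(\<Sum>y\<in>X. \<Sum>x\<in>X. P x y * (v x)\<^sup>2) = (\<Sum>x\<in>X. (v x)\<^sup>2)"
    by (subst sum.swap) (simp add: sum_distrib_right[symmetric] row_sum)
  also have "(\<Sum>y\<in>X. \<Sum>x\<in>X. P x y * (v x - v y)\<^sup>2) = (\<Sum>x\<in>X. \<Sum>y\<in>X. P x y * (v x - v y)\<^sup>2)"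
    by (rule sum.swap)
  finally show ?thesis .
qed

end

text \<open>The energy is invariant under transposing \<open>P\<close>, hence that of the
  symmetrised chain. It runs over ordered pairs without a factor 1/2, so \<open>gap\<close> is a
  lower bound for twice the spectral gap of that chain.\<close>

locale poincare_chain = lazy_doubly_stochastic_chain +
  fixes gap :: real
  assumes gap_pos: "gap > 0"
    and poincare: "(\<Sum>x\<in>X. f x) = 0 \<Longrightarrow>
      gap * (\<Sum>x\<in>X. (f x)\<^sup>2) \<le> (\<Sum>x\<in>X. \<Sum>y\<in>X. P x y * (f x - f y)\<^sup>2)"
begin

lemma dist_step_deviation_le:
  assumes "(\<Sum>x\<in>X. \<mu> x) = c * real (card X)"
  shows "(\<Sum>y\<in>X. (dist_step X P \<mu> y - c)\<^sup>2) \<le> (1 - gap / 2) * (\<Sum>x\<in>X. (\<mu> x - c)\<^sup>2)"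
proof -
  have "(\<Sum>y\<in>X. (dist_step X P \<mu> y - c)\<^sup>2) = (\<Sum>y\<in>X. (dist_step X P (\<lambda>x. \<mu> x - c) y)\<^sup>2)"
    by (intro sum.cong refl) (simp add: dist_step_diff dist_step_const)
  also have "\<dots> \<le> (\<Sum>x\<in>X. (\<mu> x - c)\<^sup>2) -
      1 / 2 * (\<Sum>x\<in>X. \<Sum>y\<in>X. P x y * ((\<mu> x - c) - (\<mu> y - c))\<^sup>2)"
    by (rule dist_step_l2_contraction)
  also have "\<dots> \<le> (\<Sum>x\<in>X. (\<mu> x - c)\<^sup>2) - 1 / 2 * (gap * (\<Sum>x\<in>X. (\<mu> x - c)\<^sup>2))"
    using assms by (intro diff_left_mono mult_left_mono poincare) (auto simp: sum_subtractf)
  finally show ?thesis by (simp add: algebra_simps)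
qed

lemma dist_step_funpow_deviation_le:
  assumes "(\<Sum>x\<in>X. \<mu> x) = c * real (card X)"
  shows "(\<Sum>y\<in>X. ((dist_step X P ^^ k) \<mu> y - c)\<^sup>2) \<le> exp (- gap * real k / 2) * (\<Sum>x\<in>X. (\<mu> x - c)\<^sup>2)"
proof (induction k)
  case (Suc k)
  let ?\<nu> = "(dist_step X P ^^ k) \<mu>"
  have "(\<Sum>y\<in>X. ((dist_step X P ^^ Suc k) \<mu> y - c)\<^sup>2) \<le> (1 - gap / 2) * (\<Sum>x\<in>X. (?\<nu> x - c)\<^sup>2)"
    using dist_step_deviation_le[of ?\<nu> c] assms by (simp add: sum_dist_step_funpow)
  also have "\<dots> \<le> exp (- gap / 2) * (\<Sum>x\<in>X. (?\<nu> x - c)\<^sup>2)"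
    using exp_ge_add_one_self[of "- gap / 2"] by (intro mult_right_mono sum_nonneg) auto
  also have "\<dots> \<le> exp (- gap / 2) * (exp (- gap * real k / 2) * (\<Sum>x\<in>X. (\<mu> x - c)\<^sup>2))"
    by (intro mult_left_mono Suc) auto
  also have "\<dots> = exp (- gap * real (Suc k) / 2) * (\<Sum>x\<in>X. (\<mu> x - c)\<^sup>2)"
    by (simp add: exp_add[symmetric] add_divide_distrib diff_divide_distrib algebra_simps)
  finally show ?case .
qed simp

text \<open>The deviation of a stationary distribution from uniform does not change in a step, yet
  it contracts by \<open>1 - gap / 2\<close>, so it is 0. This uniqueness is what gives the definite
  description its value.\<close>

lemma stationary_dist_uniform: "stationary_dist X P = pmf_of_set X"
  unfolding stationary_dist_def
proof (rule the_equality)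
  fix \<pi> assume \<pi>: "is_stationary X P \<pi>"
  define c where "c = 1 / real (card X)"
  have card: "real (card X) > 0" using finite_states states_nonempty by (simp add: card_gt_0_iff)
  have dist: "\<pi> \<in> distributions_on X" using \<pi> by (simp add: is_stationary_def)
  have "(\<Sum>y\<in>X. (pmf \<pi> y - c)\<^sup>2) = (\<Sum>y\<in>X. (dist_step X P (pmf \<pi>) y - c)\<^sup>2)"
    using \<pi> by (simp add: is_stationary_def)
  also have "\<dots> \<le> (1 - gap / 2) * (\<Sum>x\<in>X. (pmf \<pi> x - c)\<^sup>2)"
    using card sum_pmf_distributions_on[OF finite_states dist]
    by (intro dist_step_deviation_le) (simp add: c_def)
  finally have "gap * (\<Sum>x\<in>X. (pmf \<pi> x - c)\<^sup>2) \<le> 0" by (simp add: algebra_simps)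
  then have "(\<Sum>x\<in>X. (pmf \<pi> x - c)\<^sup>2) \<le> 0" using gap_pos by (simp add: mult_le_0_iff)
  then have "(\<Sum>x\<in>X. (pmf \<pi> x - c)\<^sup>2) = 0" by (intro antisym sum_nonneg) auto
  then have eq: "pmf \<pi> x = c" if "x \<in> X" for x
    using that finite_states by (auto simp: sum_nonneg_eq_0_iff)
  show "\<pi> = pmf_of_set X"
  proof (rule pmf_eqI)
    fix x
    show "pmf \<pi> x = pmf (pmf_of_set X) x"
      using eq[of x] dist finite_states states_nonempty
      by (cases "x \<in> X") (auto simp: c_def distributions_on_def pmf_eq_0_set_pmf)
  qed
qed (rule is_stationary_uniform)

text \<open>The squared deviation is at most 1 at the start, and passing from
  \<open>\<ell>\<^sup>2\<close> to total variation costs the factor \<open>card X\<close> under the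
  root.\<close>

lemma t_mix_le:
  assumes "real (card X) * exp (- gap * real k / 2) \<le> \<epsilon>\<^sup>2" "\<epsilon> > 0"
  shows "t_mix X P \<epsilon> \<le> enat k"
  unfolding t_mix_def
proof (intro SUP_least INF_lower CollectI)
  fix \<sigma> assume \<sigma>: "\<sigma> \<in> distributions_on X"
  define c where "c = 1 / real (card X)"
  have card: "real (card X) > 0" using finite_states states_nonempty by (simp add: card_gt_0_iff)
  have sum1: "(\<Sum>x\<in>X. pmf \<sigma> x) = 1" using \<sigma> finite_states by (simp add: sum_pmf_distributions_on)
  have le1: "(\<Sum>x\<in>X. (pmf \<sigma> x - c)\<^sup>2) \<le> 1"
  proof -
    have "(\<Sum>x\<in>X. (pmf \<sigma> x - c)\<^sup>2) = (\<Sum>x\<in>X. (pmf \<sigma> x)\<^sup>2) - 2 * c * (\<Sum>x\<in>X. pmf \<sigma> x) + c\<^sup>2 * real (card X)"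
      by (simp add: power2_diff sum.distrib sum_subtractf sum_distrib_left algebra_simps)
    also have "\<dots> = (\<Sum>x\<in>X. (pmf \<sigma> x)\<^sup>2) - c"
      using card by (simp add: sum1 c_def power2_eq_square)
    also have "\<dots> \<le> (\<Sum>x\<in>X. (pmf \<sigma> x)\<^sup>2)" by (simp add: c_def)
    also have "\<dots> \<le> (\<Sum>x\<in>X. pmf \<sigma> x)"
      by (intro sum_mono) (simp add: power2_eq_square mult_left_le pmf_le_1)
    finally show ?thesis by (simp add: sum1)
  qed
  let ?\<mu> = "(dist_step X P ^^ k) (pmf \<sigma>)"
  have "tv_norm X ?\<mu> (pmf (pmf_of_set X)) \<le> sqrt (real (card X) * (\<Sum>x\<in>X. (?\<mu> x - pmf (pmf_of_set X) x)\<^sup>2))"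
    by (rule tv_norm_le_l2[OF finite_states])
  also have "(\<Sum>x\<in>X. (?\<mu> x - pmf (pmf_of_set X) x)\<^sup>2) = (\<Sum>x\<in>X. (?\<mu> x - c)\<^sup>2)"
    using finite_states states_nonempty by (simp add: c_def)
  also have "\<dots> \<le> exp (- gap * real k / 2) * (\<Sum>x\<in>X. (pmf \<sigma> x - c)\<^sup>2)"
    using sum1 card by (intro dist_step_funpow_deviation_le) (simp add: c_def)
  also have "\<dots> \<le> exp (- gap * real k / 2) * 1" by (intro mult_left_mono le1) auto
  finally have "tv_norm X ?\<mu> (pmf (pmf_of_set X)) \<le> sqrt (real (card X) * exp (- gap * real k / 2))"
    by (simp add: mult_left_mono)
  also have "\<dots> \<le> \<epsilon>" using assms by (intro real_le_lsqrt) auto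
  finally show "tv_norm X ?\<mu> (pmf (stationary_dist X P)) \<le> \<epsilon>"
    by (simp add: stationary_dist_uniform)
qed

end

section \<open>Dirichlet forms on the cycle with long range edges\<close>

lemma eq_Suc_mod_iff:
  assumes "x < n" "y < (n::nat)"
  shows "y = Suc x mod n \<longleftrightarrow> x = (y + n - 1) mod n"
proof (cases "y = 0")
  case True
  have "Suc x mod n = 0 \<longleftrightarrow> Suc x = n" using assms by (auto simp: mod_Suc)
  with True assms show ?thesis by auto
next
  case False
  then have "(y + n - 1) mod n = y - 1" using assms by (simp add: mod_if)
  moreover have "y = Suc x mod n \<longleftrightarrow> y = Suc x" using False assms by (auto simp: mod_Suc)
  ultimately show ?thesis using False by auto
qed

lemma sum_eq_Suc_mod:
  fixes c :: "'b::comm_monoid_add"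
  assumes "x < n"
  shows "(\<Sum>y<n. if y = Suc x mod n then g y else 0) = (g (Suc x mod n) :: 'b)"
  using assms by (subst sum.delta) auto

lemma sum_Suc_mod_eq:
  assumes "y < n"
  shows "(\<Sum>x<n. if y = Suc x mod n then c else 0) = (c :: 'b::comm_monoid_add)"
proof -
  have "(\<Sum>x<n. if y = Suc x mod n then c else 0) = (\<Sum>x<n. if x = (y + n - 1) mod n then c else 0)"
    using assms by (intro sum.cong refl) (simp add: eq_Suc_mod_iff)
  also have "\<dots> = c" using assms by (subst sum.delta) auto
  finally show ?thesis .
qed

definition cycle_energy :: "nat \<Rightarrow> (nat \<Rightarrow> real) \<Rightarrow> real" where
  "cycle_energy n f = (\<Sum>x<n. (f x - f (Suc x mod n))\<^sup>2)"

text \<open>Each long range edge counts twice here, once per order of its ends, whereas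
  \<open>cycle_energy\<close> counts each cycle edge once.\<close>

definition matching_energy :: "nat \<Rightarrow> nat set set \<Rightarrow> (nat \<Rightarrow> real) \<Rightarrow> real" where
  "matching_energy n M f = (\<Sum>x<n. \<Sum>y<n. of_bool ({x, y} \<in> M) * (f x - f y)\<^sup>2)"

lemma energy_nonneg: "cycle_energy n f \<ge> 0" "matching_energy n M f \<ge> 0"
  by (auto simp: cycle_energy_def matching_energy_def intro!: sum_nonneg)

lemma sum_forward_edges:
  "(\<Sum>x<n. \<Sum>y<n. (if y = Suc x mod n then c else 0) * (f x - f y)\<^sup>2) = c * cycle_energy n f"
proof -
  have "(\<Sum>x<n. \<Sum>y<n. (if y = Suc x mod n then c else 0) * (f x - f y)\<^sup>2) =
      (\<Sum>x<n. \<Sum>y<n. if y = Suc x mod n then c * (f x - f y)\<^sup>2 else 0)"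
    by (intro sum.cong refl) simp
  also have "\<dots> = (\<Sum>x<n. c * (f x - f (Suc x mod n))\<^sup>2)"
    by (intro sum.cong refl sum_eq_Suc_mod) simp
  finally show ?thesis by (simp add: cycle_energy_def sum_distrib_left)
qed

lemma sum_backward_edges:
  "(\<Sum>x<n. \<Sum>y<n. (if x = Suc y mod n then c else 0) * (f x - f y)\<^sup>2) = c * cycle_energy n f"
  by (subst sum.swap) (simp add: sum_forward_edges[symmetric] power2_commute)

text \<open>The drift \<open>r\<close> cancels because a cycle edge has the same energy in both
  directions, and the holding probabilities vanish with the differences on the diagonal.\<close>

lemma hom_chain_energy:
  "(\<Sum>x<n. \<Sum>y<n. hom_chain qc ql r d n M x y * (f x - f y)\<^sup>2) =
     2 * qc * cycle_energy n f + ql / d * matching_energy n M f"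
proof -
  have "(\<Sum>x<n. \<Sum>y<n. hom_chain qc ql r d n M x y * (f x - f y)\<^sup>2) =
    (\<Sum>x<n. \<Sum>y<n. (if y = Suc x mod n then qc + r else 0) * (f x - f y)\<^sup>2 +
       (if x = Suc y mod n then qc - r else 0) * (f x - f y)\<^sup>2 +
       ql / d * (of_bool ({x, y} \<in> M) * (f x - f y)\<^sup>2))"
    by (intro sum.cong refl) (auto simp: hom_chain_def move_prob_def algebra_simps)
  also have "\<dots> = (qc + r) * cycle_energy n f + (qc - r) * cycle_energy n f + ql / d * matching_energy n M f"
    by (simp only: sum.distrib sum_distrib_left[symmetric] sum_forward_edges sum_backward_edges matching_energy_def)
  finally show ?thesis by (simp add: algebra_simps)
qed

text \<open>Every node has one successor and one predecessor on the cycle and long range moves are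
  symmetric, so as much probability moves into a node as out of it, whatever the drift. Laziness
  makes the diagonal nonnegative.\<close>

lemma hom_chain_doubly_stochastic:
  assumes "n > 0" "\<bar>r\<bar> \<le> qc" "0 \<le> ql / d"
    and lazy: "lazy_chain {..<n} (hom_chain qc ql r d n M)"
  shows "lazy_doubly_stochastic_chain {..<n} (hom_chain qc ql r d n M)"
proof
  let ?P = "hom_chain qc ql r d n M" and ?m = "move_prob qc ql r d n M"
  show "finite {..<n}" "{..<n} \<noteq> {}" using assms by auto
  show lz: "1 / 2 \<le> ?P x x" if "x \<in> {..<n}" for x
    using lazy that by (auto simp: lazy_chain_def)
  show "0 \<le> ?P x y" if "x \<in> {..<n}" "y \<in> {..<n}" for x y
    using lz[OF that(1)] assms(2,3) by (cases "x = y") (auto simp: hom_chain_def move_prob_def)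
  show row: "(\<Sum>y<n. ?P x y) = 1" if "x \<in> {..<n}" for x
  proof -
    have "(\<Sum>y<n. ?P x y) = ?P x x + (\<Sum>y\<in>{..<n} - {x}. ?P x y)"
      using that by (intro sum.remove) auto
    also have "(\<Sum>y\<in>{..<n} - {x}. ?P x y) = (\<Sum>y\<in>{..<n} - {x}. ?m x y)"
      by (intro sum.cong refl) (auto simp: hom_chain_def)
    finally show ?thesis by (simp add: hom_chain_def)
  qed
  show "(\<Sum>x<n. ?P x y) = 1" if y: "y \<in> {..<n}" for y
  proof -
    have rowm: "(\<Sum>x<n. ?m y x) = 2 * qc + (\<Sum>x<n. if {x, y} \<in> M then ql / d else 0)"
      using y unfolding move_prob_def sum.distrib
      by (simp add: sum_eq_Suc_mod sum_Suc_mod_eq insert_commute)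
    have colm: "(\<Sum>x<n. ?m x y) = 2 * qc + (\<Sum>x<n. if {x, y} \<in> M then ql / d else 0)"
      using y unfolding move_prob_def sum.distrib
      by (simp add: sum_eq_Suc_mod sum_Suc_mod_eq)
    have "(\<Sum>x<n. ?P x y) = ?P y y + (\<Sum>x\<in>{..<n} - {y}. ?P x y)"
      using y by (intro sum.remove) auto
    also have "(\<Sum>x\<in>{..<n} - {y}. ?P x y) = (\<Sum>x\<in>{..<n} - {y}. ?m x y)"
      by (intro sum.cong refl) (auto simp: hom_chain_def)
    also have "\<dots> = (\<Sum>x\<in>{..<n} - {y}. ?m y x)"
      using rowm colm y by (simp add: sum_diff1)
    also have "?P y y + \<dots> = 1" by (simp add: hom_chain_def)
    finally show ?thesis .
  qed
qed

text \<open>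
  Contracting each segment between consecutive hubs to a point turns the graph into a cycle with
  a perfect matching on the \<open>m\<close> hubs \<open>p 0, \<dots>, p (m - 1)\<close>; the segments themselves cost a
  factor \<open>L\<^sup>2\<close>.
\<close>

lemma sum_segments:
  fixes p :: "nat \<Rightarrow> nat"
  assumes "p 0 = 0" "\<And>i. i < m \<Longrightarrow> p i \<le> p (Suc i)"
  shows "(\<Sum>x<p m. g x) = (\<Sum>i<m. \<Sum>x\<in>{p i..<p (Suc i)}. g x)"
proof -
  have "(\<Sum>x<p j. g x) = (\<Sum>i<j. \<Sum>x\<in>{p i..<p (Suc i)}. g x)" if "j \<le> m" for j
    using that
  proof (induction j)
    case (Suc j)
    have "(\<Sum>x<p (Suc j). g x) = (\<Sum>x\<in>{0..<p j}. g x) + (\<Sum>x\<in>{p j..<p (Suc j)}. g x)"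
      unfolding lessThan_atLeast0 using assms(2)[of j] Suc.prems
      by (intro sum.atLeastLessThan_concat[symmetric]) auto
    with Suc show ?case by (simp add: lessThan_atLeast0)
  qed (simp add: assms(1))
  then show ?thesis by simp
qed

lemma matching_energy_hubs_le:
  fixes p :: "nat \<Rightarrow> nat"
  assumes "inj_on p {..<m}" "p ` {..<m} \<subseteq> {..<n}"
  shows "(\<Sum>i<m. \<Sum>j<m. of_bool ({p i, p j} \<in> M) * (f (p i) - f (p j))\<^sup>2) \<le> matching_energy n M f"
proof -
  define g where "g = (\<lambda>(x, y). of_bool ({x, y} \<in> M) * (f x - f y)\<^sup>2)"
  have "(\<Sum>i<m. \<Sum>j<m. of_bool ({p i, p j} \<in> M) * (f (p i) - f (p j))\<^sup>2) =
      (\<Sum>z\<in>{..<m} \<times> {..<m}. g (map_prod p p z))"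
    unfolding sum.cartesian_product by (intro sum.cong refl) (auto simp: g_def)
  also have "\<dots> = (\<Sum>z\<in>map_prod p p ` ({..<m} \<times> {..<m}). g z)"
    using assms(1) by (subst sum.reindex) (auto intro: map_prod_inj_on simp: o_def)
  also have "\<dots> \<le> (\<Sum>z\<in>{..<n} \<times> {..<n}. g z)"
    using assms(2) by (intro sum_mono2) (auto simp: g_def)
  also have "\<dots> = matching_energy n M f"
    unfolding matching_energy_def sum.cartesian_product g_def ..
  finally show ?thesis .
qed

text \<open>One factor \<open>L\<close> comes from Cauchy-Schwarz along a path inside a segment, the
  other from the number of nodes in the segment. The steps between hubs in \<open>hubs\<close> cost
  the first factor, and spreading a hub value over its segment costs the second.\<close>

lemma cycle_poincare_of_hubs:
  fixes p :: "nat \<Rightarrow> nat" and f :: "nat \<Rightarrow> real"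
  assumes p0: "p 0 = 0" and pm: "p m = n" and m: "m > 0"
    and mono: "\<And>i. i < m \<Longrightarrow> p i < p (Suc i)"
    and gap: "\<And>i. i < m \<Longrightarrow> real (p (Suc i) - p i) \<le> L" and L: "1 \<le> L"
    and K: "0 \<le> K" and B: "0 \<le> B"
    and hubs: "(\<Sum>i<m. (f (p i) - c)\<^sup>2) \<le>
      K * (2 * (\<Sum>i<m. (f (p i) - f (p (Suc i mod m)))\<^sup>2) + B)"
  shows "(\<Sum>x<n. (f x - c)\<^sup>2) \<le> (2 + 4 * K) * L\<^sup>2 * (cycle_energy n f + B)"
proof -
  have p_lt: "p i < n" if "i < m" for i
  proof -
    have "p i < p j" if "i < j" "j \<le> m" for j
      using that
    proof (induction j)
      case (Suc j)
      then show ?case using mono[of j] by (cases "i = j") auto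
    qed simp
    from this[of m] that show ?thesis by (simp add: pm)
  qed
  \<comment> \<open>With \<open>F n = f 0\<close> the last segment, ending at
    \<open>p m = n\<close>, needs no special treatment.\<close>
  define F where "F z = f (z mod n)" for z
  define D where "D z = (F (Suc z) - F z)\<^sup>2" for z
  define E where "E i = (\<Sum>z\<in>{p i..<p (Suc i)}. D z)" for i
  have D0: "D z \<ge> 0" for z by (simp add: D_def)
  have F_eq: "F z = f z" if "z < n" for z using that by (simp add: F_def)
  have E0: "E i \<ge> 0" for i unfolding E_def by (intro sum_nonneg D0)
  have sumE: "(\<Sum>i<m. E i) = cycle_energy n f"
  proof -
    have "(\<Sum>i<m. E i) = (\<Sum>z<p m. D z)"
      unfolding E_def using mono by (intro sum_segments[symmetric] p0) (auto intro: less_imp_le)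
    also have "\<dots> = cycle_energy n f"
      unfolding cycle_energy_def pm D_def F_def
      by (intro sum.cong refl) (simp add: power2_commute)
    finally show ?thesis .
  qed
  have path: "(F x - F (p i))\<^sup>2 \<le> L * E i" if "i < m" "p i \<le> x" "x \<le> p (Suc i)" for i x
  proof -
    have "(F x - F (p i))\<^sup>2 = (\<Sum>z\<in>{p i..<x}. F (Suc z) - F z)\<^sup>2"
      using that by (subst sum_Suc_diff') auto
    also have "\<dots> \<le> (\<Sum>z\<in>{p i..<x}. D z) * real (card {p i..<x})"
      unfolding D_def by (rule sum_squared_le_sum_of_squares)
    also have "\<dots> \<le> E i * L"
    proof (intro mult_mono)
      show "(\<Sum>z\<in>{p i..<x}. D z) \<le> E i"
        unfolding E_def using that D0 by (intro sum_mono2) auto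
      show "real (card {p i..<x}) \<le> L" using gap[OF that(1)] that by simp
    qed (use E0 in auto)
    finally show ?thesis by (simp add: mult.commute)
  qed
  have F_next: "F (p (Suc i)) = f (p (Suc i mod m))" if "i < m" for i
  proof (cases "Suc i = m")
    case True
    then show ?thesis by (simp add: F_def pm p0)
  next
    case False
    with that have "Suc i < m" by simp
    then show ?thesis by (simp add: F_eq p_lt)
  qed
  have steps: "(\<Sum>i<m. (f (p i) - f (p (Suc i mod m)))\<^sup>2) \<le> L * cycle_energy n f"
  proof -
    have "(f (p i) - f (p (Suc i mod m)))\<^sup>2 \<le> L * E i" if "i < m" for i
      using path[of i "p (Suc i)"] mono[of i] that F_next F_eq p_lt
      by (simp add: power2_commute)
    then have "(\<Sum>i<m. (f (p i) - f (p (Suc i mod m)))\<^sup>2) \<le> (\<Sum>i<m. L * E i)"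
      by (intro sum_mono) simp
    then show ?thesis by (simp add: sum_distrib_left[symmetric] sumE)
  qed
  have "(\<Sum>x<n. (f x - c)\<^sup>2) = (\<Sum>i<m. \<Sum>x\<in>{p i..<p (Suc i)}. (f x - c)\<^sup>2)"
    unfolding pm[symmetric] using mono by (intro sum_segments p0) (auto intro: less_imp_le)
  also have "\<dots> \<le> (\<Sum>i<m. 2 * (L\<^sup>2 * E i) + 2 * L * (f (p i) - c)\<^sup>2)"
  proof (rule sum_mono)
    fix i assume "i \<in> {..<m}"
    then have i: "i < m" by simp
    have "(f x - c)\<^sup>2 \<le> 2 * (L * E i) + 2 * (f (p i) - c)\<^sup>2" if x: "x \<in> {p i..<p (Suc i)}" for x
    proof -
      have "x < n"
      proof -
        have "p (Suc i) \<le> n" using p_lt[of "Suc i"] i pm by (cases "Suc i = m") auto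
        with x show ?thesis by simp
      qed
      then have "(f x - f (p i))\<^sup>2 \<le> L * E i"
        using path[of i x] x i by (simp add: F_eq p_lt)
      moreover have "(f x - c)\<^sup>2 \<le> 2 * (f x - f (p i))\<^sup>2 + 2 * (f (p i) - c)\<^sup>2"
        using zero_le_power2[of "(f x - f (p i)) - (f (p i) - c)"]
        by (simp add: power2_eq_square algebra_simps)
      ultimately show ?thesis by linarith
    qed
    then have "(\<Sum>x\<in>{p i..<p (Suc i)}. (f x - c)\<^sup>2) \<le>
        (\<Sum>x\<in>{p i..<p (Suc i)}. 2 * (L * E i) + 2 * (f (p i) - c)\<^sup>2)"
      by (rule sum_mono)
    also have "\<dots> = real (p (Suc i) - p i) * (2 * (L * E i) + 2 * (f (p i) - c)\<^sup>2)" by simp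
    also have "\<dots> \<le> L * (2 * (L * E i) + 2 * (f (p i) - c)\<^sup>2)"
      using gap[OF i] E0 L by (intro mult_right_mono) auto
    finally show "(\<Sum>x\<in>{p i..<p (Suc i)}. (f x - c)\<^sup>2) \<le> 2 * (L\<^sup>2 * E i) + 2 * L * (f (p i) - c)\<^sup>2"
      by (simp add: power2_eq_square algebra_simps)
  qed
  also have "\<dots> = 2 * (L\<^sup>2 * cycle_energy n f) + 2 * L * (\<Sum>i<m. (f (p i) - c)\<^sup>2)"
    by (simp only: sum.distrib sum_distrib_left[symmetric] sumE)
  also have "\<dots> \<le> 2 * (L\<^sup>2 * cycle_energy n f) + 2 * L * (K * (2 * (L * cycle_energy n f) + L * B))"
  proof -
    have "1 * B \<le> L * B" by (intro mult_right_mono L B)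
    then have "(\<Sum>i<m. (f (p i) - c)\<^sup>2) \<le> K * (2 * (L * cycle_energy n f) + L * B)"
      using steps by (intro order.trans[OF hubs] mult_left_mono K add_mono) auto
    then show ?thesis using L by (intro add_left_mono mult_left_mono) auto
  qed
  also have "\<dots> \<le> (2 + 4 * K) * L\<^sup>2 * (cycle_energy n f + B)"
  proof -
    have "0 \<le> 2 * L\<^sup>2 * B + 2 * K * L\<^sup>2 * B" using K B by simp
    then show ?thesis by (simp add: power2_eq_square algebra_simps)
  qed
  finally show ?thesis .
qed

text \<open>Here \<open>196608 = 3 * 256\<^sup>2\<close>, where 3 bounds the weighted degree (two
  cycle edges and one partner) and 1/256 is the cut constant. The cycle term is doubled because
  \<open>w\<close> contains both directions of a cycle edge.\<close>

lemma expander_poincare: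
  fixes p :: "nat \<Rightarrow> 'a" and f :: "nat \<Rightarrow> real"
  assumes M: "M \<in> perfect_matchings (p ` {..<m})" and inj: "inj_on p {..<m}"
    and expanding: "\<And>S. S \<subseteq> {..<m} \<Longrightarrow> S \<noteq> {} \<Longrightarrow> 2 * card S \<le> m \<Longrightarrow> \<not> nonexpanding p m M S"
  shows "\<exists>c. (\<Sum>i<m. (f i - c)\<^sup>2) \<le> 196608 *
    (2 * (\<Sum>i<m. (f i - f (Suc i mod m))\<^sup>2) + (\<Sum>i<m. \<Sum>j<m. of_bool ({p i, p j} \<in> M) * (f i - f j)\<^sup>2))"
proof -
  define w :: "nat \<Rightarrow> nat \<Rightarrow> real" where "w i j = (if j = Suc i mod m then 1 else 0) +
    (if i = Suc j mod m then 1 else 0) + of_bool ({p i, p j} \<in> M)" for i j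
  have dis: "disjoint M" and c2: "\<And>e. e \<in> M \<Longrightarrow> card e = 2"
    using M by (auto simp: perfect_matchings_def partition_on_def)
  have deg: "(\<Sum>j<m. w i j) \<le> 3" if i: "i \<in> {..<m}" for i
  proof -
    have "(\<Sum>j<m. of_bool ({p i, p j} \<in> M)) = real (card {j\<in>{..<m}. {p i, p j} \<in> M})"
      by (simp add: of_bool_def sum.If_cases Int_def)
    also have "card {j\<in>{..<m}. {p i, p j} \<in> M} \<le> 1"
    proof -
      have "j = k" if "j \<in> {j\<in>{..<m}. {p i, p j} \<in> M}" "k \<in> {j\<in>{..<m}. {p i, p j} \<in> M}" for j k
      proof -
        have jk: "j < m" "k < m" "{p i, p j} \<in> M" "{p i, p k} \<in> M" using that by auto
        then have eq: "{p i, p j} = {p i, p k}" using disjointD[OF dis jk(3,4)] by blast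
        then have "p j = p k" by (auto simp: doubleton_eq_iff)
        then show "j = k" using inj jk by (auto dest: inj_onD)
      qed
      then show ?thesis by (simp add: card_le_Suc0_iff_eq)
    qed
    finally have "(\<Sum>j<m. of_bool ({p i, p j} \<in> M)) \<le> (1::real)" by simp
    then show ?thesis using i by (simp add: w_def sum.distrib sum_eq_Suc_mod sum_Suc_mod_eq)
  qed
  have cut: "1 / 256 * real (card S) \<le> (\<Sum>i\<in>S. \<Sum>j\<in>{..<m} - S. w i j)"
    if S: "S \<subseteq> {..<m}" "2 * card S \<le> card {..<m}" for S
  proof (cases "S = {}")
    case False
    have finS: "finite S" using S(1) finite_subset by blast
    have "card (cyclic_boundary m S) > card S div 256 \<or> card (matched_outside p m M S) > card S div 256"
      using expanding[of S] S False by (auto simp: nonexpanding_def not_le)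
    moreover have "real (card (cyclic_boundary m S)) \<le> (\<Sum>i\<in>S. \<Sum>j\<in>{..<m} - S. w i j)"
    proof -
      \<comment> \<open>Boundary edges that leave \<open>S\<close> clockwise and those that enter it
        clockwise; they correspond to the two cycle terms of \<open>w\<close>.\<close>
      define S1 S2 where "S1 = {i \<in> S. Suc i mod m \<notin> S}" and "S2 = {j \<in> {..<m} - S. Suc j mod m \<in> S}"
      have "cyclic_boundary m S = S1 \<union> S2"
        using S(1) by (auto simp: cyclic_boundary_def S1_def S2_def)
      then have "card (cyclic_boundary m S) \<le> card S1 + card S2" by (simp add: card_Un_le)
      also have "real \<dots> = (\<Sum>i\<in>S. \<Sum>j\<in>{..<m} - S. if j = Suc i mod m then 1 else 0) +
          (\<Sum>i\<in>S. \<Sum>j\<in>{..<m} - S. if i = Suc j mod m then 1 else 0)"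
      proof -
        have "(\<Sum>i\<in>S. \<Sum>j\<in>{..<m} - S. if j = Suc i mod m then 1 else 0) =
            (\<Sum>i\<in>S. if Suc i mod m \<notin> S then 1 else (0::real))"
          using S(1) by (intro sum.cong refl) (auto simp: sum.delta)
        moreover have "(\<Sum>i\<in>S. \<Sum>j\<in>{..<m} - S. if i = Suc j mod m then 1 else 0) =
            (\<Sum>j\<in>{..<m} - S. if Suc j mod m \<in> S then 1 else (0::real))"
          using finS by (subst sum.swap) (auto intro!: sum.cong simp: sum.delta)
        ultimately show ?thesis
          using finS by (simp add: S1_def S2_def sum.If_cases Int_def)
      qed
      also have "\<dots> \<le> (\<Sum>i\<in>S. \<Sum>j\<in>{..<m} - S. w i j)"
        unfolding sum.distrib[symmetric] by (intro sum_mono) (simp add: w_def)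
      finally show ?thesis by simp
    qed
    moreover have "real (card (matched_outside p m M S)) \<le> (\<Sum>i\<in>S. \<Sum>j\<in>{..<m} - S. w i j)"
    proof -
      have "real (card (matched_outside p m M S)) =
          (\<Sum>i\<in>S. if \<exists>j\<in>{..<m} - S. {p i, p j} \<in> M then 1 else 0)"
        using finS by (simp add: matched_outside_def sum.If_cases Int_def)
      also have "\<dots> \<le> (\<Sum>i\<in>S. \<Sum>j\<in>{..<m} - S. w i j)"
      proof (rule sum_mono)
        fix i assume "i \<in> S"
        have w0: "w i j \<ge> 0" for j by (simp add: w_def)
        show "(if \<exists>j\<in>{..<m} - S. {p i, p j} \<in> M then 1 else 0) \<le> (\<Sum>j\<in>{..<m} - S. w i j)"
        proof (cases "\<exists>j\<in>{..<m} - S. {p i, p j} \<in> M")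
          case True
          then obtain j where j: "j \<in> {..<m} - S" "{p i, p j} \<in> M" by blast
          then have "1 \<le> w i j" by (simp add: w_def)
          also have "\<dots> \<le> (\<Sum>j\<in>{..<m} - S. w i j)"
            using j(1) w0 by (intro member_le_sum) auto
          finally show ?thesis using True by simp
        qed (simp add: w0 sum_nonneg)
      qed
      finally show ?thesis .
    qed
    ultimately have "real (card S div 256) + 1 \<le> (\<Sum>i\<in>S. \<Sum>j\<in>{..<m} - S. w i j)" by linarith
    moreover have "real (card S) / 256 \<le> real (card S div 256) + 1" by linarith
    ultimately show ?thesis by simp
  qed simp
  have "w x y = w y x" for x y by (simp add: w_def insert_commute)
  moreover have "w x y \<ge> 0" for x y by (simp add: w_def)
  ultimately obtain c where c: "(1 / 256)\<^sup>2 * (\<Sum>i<m. (f i - c)\<^sup>2) \<le>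
      3 * (\<Sum>i<m. \<Sum>j<m. w i j * (f i - f j)\<^sup>2)"
    using cheeger_inequality[of "{..<m}" w 3 "1 / 256" f] deg cut by auto
  also have "(\<Sum>i<m. \<Sum>j<m. w i j * (f i - f j)\<^sup>2) =
      2 * (\<Sum>i<m. (f i - f (Suc i mod m))\<^sup>2) + (\<Sum>i<m. \<Sum>j<m. of_bool ({p i, p j} \<in> M) * (f i - f j)\<^sup>2)"
    unfolding w_def distrib_right sum.distrib sum_forward_edges sum_backward_edges
    by (simp add: cycle_energy_def)
  finally show ?thesis by (intro exI[of _ c]) (simp add: power2_eq_square)
qed

section \<open>The random graph model M1\<close>

lemma nat_floor_bounds:
  fixes x :: real
  assumes "0 \<le> x"
  shows "real (nat \<lfloor>x\<rfloor>) \<le> x" "x < real (nat \<lfloor>x\<rfloor>) + 1"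
  using assms by linarith+

definition num_hubs :: "real \<Rightarrow> nat \<Rightarrow> nat" where
  "num_hubs \<alpha> n = 2 * nat \<lfloor>real n powr (2 - \<alpha>)\<rfloor>"

text \<open>The value \<open>n\<close> at index \<open>num_hubs \<alpha> n\<close> closes the last segment of the cycle.\<close>

definition hub_pos :: "real \<Rightarrow> nat \<Rightarrow> nat \<Rightarrow> nat" where
  "hub_pos \<alpha> n i =
     (if i < num_hubs \<alpha> n then nat \<lfloor>real i * real n powr (\<alpha> - 1) / 2\<rfloor> else n)"

definition expanding_matching :: "real \<Rightarrow> nat \<Rightarrow> nat set set \<Rightarrow> bool" where
  "expanding_matching \<alpha> n M \<longleftrightarrow> (\<forall>S\<subseteq>{..<num_hubs \<alpha> n}.
     S \<noteq> {} \<longrightarrow> 2 * card S \<le> num_hubs \<alpha> n \<longrightarrow> \<not> nonexpanding (hub_pos \<alpha> n) (num_hubs \<alpha> n) M S)"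

lemma hubs_eq: "hubs \<alpha> n = hub_pos \<alpha> n ` {..<num_hubs \<alpha> n}"
  by (auto simp: hubs_def hub_pos_def num_hubs_def)

text \<open>What is needed of a large \<open>n\<close>. The value 9 is a convenient one: distinct
  hubs require a spacing parameter above 2, and the choice of \<open>T\<close> in
  \<open>t_mix_lower\<close> requires at least 16/3. With \<open>n \<ge> 3\<close> one has
  \<open>ln n \<ge> 1\<close>.\<close>

locale hub_cycle =
  fixes \<alpha> :: real and n :: nat
  assumes spacing_ge: "real n powr (\<alpha> - 1) \<ge> 9" and hubs_exist: "real n powr (2 - \<alpha>) \<ge> 1"
    and n_ge: "n \<ge> 3"
begin

abbreviation "G \<equiv> real n powr (\<alpha> - 1)"
abbreviation "m \<equiv> num_hubs \<alpha> n"
abbreviation "p \<equiv> hub_pos \<alpha> n"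

lemma m_pos: "m > 0"
  using hubs_exist by (simp add: num_hubs_def)

lemma even_m: "even m"
  by (simp add: num_hubs_def)

text \<open>As \<open>n powr (2 - \<alpha>) * G = n\<close>, rounding the first factor down loses
  less than one \<open>G\<close>.\<close>

lemma hubs_span: "real m * G / 2 \<le> real n" "real n < real m * G / 2 + G"
proof -
  have prod: "real n powr (2 - \<alpha>) * G = real n"
    using n_ge by (simp add: powr_add[symmetric])
  have k: "real (nat \<lfloor>real n powr (2 - \<alpha>)\<rfloor>) \<le> real n powr (2 - \<alpha>)"
    "real n powr (2 - \<alpha>) < real (nat \<lfloor>real n powr (2 - \<alpha>)\<rfloor>) + 1"
    by (simp_all only: nat_floor_bounds powr_ge_zero)
  have eq: "real m * G / 2 = real (nat \<lfloor>real n powr (2 - \<alpha>)\<rfloor>) * G"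
    unfolding num_hubs_def by simp
  have 1: "real (nat \<lfloor>real n powr (2 - \<alpha>)\<rfloor>) * G \<le> real n"
    using mult_right_mono[OF k(1), of G] by (simp add: prod)
  have 2: "real n < (real (nat \<lfloor>real n powr (2 - \<alpha>)\<rfloor>) + 1) * G"
    using mult_strict_right_mono[OF k(2), of G] n_ge by (simp add: prod)
  show "real m * G / 2 \<le> real n" "real n < real m * G / 2 + G"
    using 1 2 unfolding eq distrib_right mult_1 by simp_all
qed

lemma spacing_le: "G \<le> real n"
proof -
  have "2 \<le> real m" using m_pos even_m by (auto elim!: evenE)
  then have "2 * G \<le> real m * G" by (intro mult_right_mono) auto
  then show ?thesis using hubs_span(1) by linarith
qed

lemma hub_pos_bounds:
  assumes "i < m"
  shows "real (p i) \<le> real i * G / 2" "real i * G / 2 < real (p i) + 1"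
  using assms nat_floor_bounds[of "real i * G / 2"] by (simp_all add: hub_pos_def)

lemma hub_pos_0: "p 0 = 0"
  using m_pos by (simp add: hub_pos_def)

lemma hub_pos_end: "p m = n"
  by (simp add: hub_pos_def)

text \<open>Ordinary segments have length about \<open>G / 2\<close>. The bound \<open>2 * G\<close>
  also covers the last one, which collects the remainder from rounding the number of hubs.\<close>

lemma hub_pos_step:
  assumes "i < m"
  shows "p i < p (Suc i)" "real (p (Suc i) - p i) \<le> 2 * G"
proof -
  have *: "real (p i) < real (p (Suc i)) \<and> real (p (Suc i)) \<le> real (p i) + 2 * G"
  proof (cases "Suc i = m")
    case True
    have "real m = real i + 1" using True[symmetric] by simp
    then have "real m * G / 2 = real i * G / 2 + G / 2" by (simp add: field_simps)
    then show ?thesis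
      using hubs_span hub_pos_bounds[OF assms] spacing_ge unfolding True hub_pos_end by linarith
  next
    case False
    then have "Suc i < m" using assms by simp
    moreover have "real (Suc i) * G / 2 = real i * G / 2 + G / 2" by (simp add: field_simps)
    ultimately show ?thesis
      using hub_pos_bounds[OF assms] hub_pos_bounds[of "Suc i"] spacing_ge by linarith
  qed
  then show "p i < p (Suc i)" "real (p (Suc i) - p i) \<le> 2 * G" by simp_all
qed

lemma hub_pos_strict_mono: "i < j \<Longrightarrow> j \<le> m \<Longrightarrow> p i < p j"
proof (induction j)
  case (Suc j)
  then show ?case using hub_pos_step(1)[of j] by (cases "i = j") auto
qed simp

lemma hub_pos_inj: "inj_on p {..<m}"
  by (rule inj_onI) (metis hub_pos_strict_mono lessThan_iff less_imp_le linorder_neqE_nat less_irrefl)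

lemma hub_pos_image: "p ` {..<m} \<subseteq> {..<n}"
  using hub_pos_strict_mono[of _ m] by (auto simp: hub_pos_end)

lemma card_hubs: "card (hubs \<alpha> n) = m"
  by (simp add: hubs_eq card_image hub_pos_inj)

lemma set_pmf_M1: "set_pmf (M1 \<alpha> n) = perfect_matchings (hubs \<alpha> n)"
  unfolding M1_def
  by (intro set_pmf_of_set perfect_matchings_nonempty perfect_matchings_finite)
     (auto simp: card_hubs even_m, simp_all add: hubs_eq)

lemma prob_not_expanding_le:
  "measure_pmf.prob (M1 \<alpha> n) {M. \<not> expanding_matching \<alpha> n M} \<le>
     4 * (\<Sum>s. real s * exp (- ln 2 / 4) ^ s) / sqrt (real m)"
proof -
  have "{M. \<not> expanding_matching \<alpha> n M} =
      {M. \<exists>S\<subseteq>{..<m}. S \<noteq> {} \<and> 2 * card S \<le> m \<and> nonexpanding p m M S}"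
    by (auto simp: expanding_matching_def)
  then show ?thesis
    using nonexpanding_prob_le[OF hub_pos_inj even_m m_pos] by (simp add: M1_def hubs_eq)
qed

text \<open>The constant is \<open>(2 + 4 * 196608) * 2\<^sup>2\<close>, from segments of length at
  most \<open>L = 2 * G\<close>. Since \<open>f\<close> has mean zero, replacing \<open>c\<close> by
  0 only decreases the left side.\<close>

lemma hub_cycle_poincare:
  assumes M: "M \<in> perfect_matchings (hubs \<alpha> n)" and expanding: "expanding_matching \<alpha> n M"
    and sum0: "(\<Sum>x<n. f x) = 0"
  shows "(\<Sum>x<n. (f x)\<^sup>2) \<le> 3145736 * G\<^sup>2 * (cycle_energy n f + matching_energy n M f)"
proof -
  define B where "B = (\<Sum>i<m. \<Sum>j<m. of_bool ({p i, p j} \<in> M) * (f (p i) - f (p j))\<^sup>2)"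
  obtain c where c: "(\<Sum>i<m. (f (p i) - c)\<^sup>2) \<le>
      196608 * (2 * (\<Sum>i<m. (f (p i) - f (p (Suc i mod m)))\<^sup>2) + B)"
    using expander_poincare[of M p m "\<lambda>i. f (p i)"] M expanding hub_pos_inj
    unfolding B_def hubs_eq expanding_matching_def by blast
  have "(\<Sum>x<n. (f x - c)\<^sup>2) = (\<Sum>x<n. (f x)\<^sup>2) - 2 * c * (\<Sum>x<n. f x) + real n * c\<^sup>2"
    by (simp add: power2_diff sum.distrib sum_subtractf sum_distrib_left algebra_simps)
  then have "(\<Sum>x<n. (f x)\<^sup>2) \<le> (\<Sum>x<n. (f x - c)\<^sup>2)" by (simp add: sum0)
  also have "\<dots> \<le> (2 + 4 * 196608) * (2 * G)\<^sup>2 * (cycle_energy n f + B)"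
    using c hub_pos_0 hub_pos_end m_pos hub_pos_step spacing_ge
    by (intro cycle_poincare_of_hubs[where p = p and m = m]) (auto simp: B_def intro!: sum_nonneg)
  also have "\<dots> \<le> (2 + 4 * 196608) * (2 * G)\<^sup>2 * (cycle_energy n f + matching_energy n M f)"
    unfolding B_def
    by (intro mult_left_mono add_left_mono matching_energy_hubs_le hub_pos_inj hub_pos_image) auto
  finally show ?thesis by (simp add: power_mult_distrib)
qed

text \<open>Cycle edges have weight \<open>2 * qc\<close> and long range edges
  \<open>ql / d\<close>; as \<open>d \<ge> 1\<close>, both are at least
  \<open>min (2 * qc) ql / d\<close>, so only one factor \<open>d\<close> is lost.\<close>

lemma hom_chain_poincare:
  assumes "\<bar>r\<bar> \<le> qc" "qc > 0" "ql > 0" "d \<ge> 1"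
    and M: "M \<in> perfect_matchings (hubs \<alpha> n)" and expanding: "expanding_matching \<alpha> n M"
    and lazy: "lazy_chain {..<n} (hom_chain qc ql r d n M)"
  shows "poincare_chain {..<n} (hom_chain qc ql r d n M)
    (min (2 * qc) ql / (3145736 * d * G\<^sup>2))"
proof -
  define \<kappa> where "\<kappa> = min (2 * qc) ql"
  define C :: real where "C = 3145736"
  interpret lazy_doubly_stochastic_chain "{..<n}" "hom_chain qc ql r d n M"
    using assms n_ge by (intro hom_chain_doubly_stochastic) auto
  have G: "G > 0" using spacing_ge by linarith
  have \<kappa>: "\<kappa> > 0" using assms by (simp add: \<kappa>_def)
  show ?thesis
  proof
    show "0 < min (2 * qc) ql / (3145736 * d * G\<^sup>2)" using assms G by simp
    fix f :: "nat \<Rightarrow> real" assume "(\<Sum>x<n. f x) = 0"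
    then have "(\<Sum>x<n. (f x)\<^sup>2) \<le> C * G\<^sup>2 * (cycle_energy n f + matching_energy n M f)"
      using hub_cycle_poincare[OF M expanding] by (simp add: C_def)
    then have "\<kappa> / (C * d * G\<^sup>2) * (\<Sum>x<n. (f x)\<^sup>2) \<le>
        \<kappa> / (C * d * G\<^sup>2) * (C * G\<^sup>2 * (cycle_energy n f + matching_energy n M f))"
      using assms(4) \<kappa> by (intro mult_left_mono) (auto simp: C_def)
    also have "\<dots> = \<kappa> / d * cycle_energy n f + \<kappa> / d * matching_energy n M f"
      using G assms(4) by (simp add: C_def field_simps)
    also have "\<dots> \<le> 2 * qc * cycle_energy n f + ql / d * matching_energy n M f"
    proof (intro add_mono mult_right_mono energy_nonneg)
      have "\<kappa> / d \<le> \<kappa> / 1" using assms(4) \<kappa> by (intro divide_left_mono) auto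
      then show "\<kappa> / d \<le> 2 * qc" by (simp add: \<kappa>_def)
      show "\<kappa> / d \<le> ql / d" using assms(4) by (intro divide_right_mono) (auto simp: \<kappa>_def)
    qed
    finally show "min (2 * qc) ql / (3145736 * d * G\<^sup>2) * (\<Sum>x<n. (f x)\<^sup>2) \<le>
        (\<Sum>x<n. \<Sum>y<n. hom_chain qc ql r d n M x y * (f x - f y)\<^sup>2)"
      by (simp add: hom_chain_energy \<kappa>_def C_def)
  qed
qed

section \<open>Lower and upper bound on the mixing time for fixed n\<close>

text \<open>
  The whole range \<open>{1..2 * T + 1}\<close> lies strictly between hubs 0 and 1, as \<open>p 1 \<ge> G / 2 - 1\<close>.
\<close>

lemma hom_chain_stays_in_segment:
  assumes M: "M \<in> perfect_matchings (hubs \<alpha> n)" and T: "2 * real T + 2 \<le> G / 2"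
    and "t \<le> T" "y < n"
    and "(dist_step {..<n} (hom_chain qc ql r d n M) ^^ t) (pmf (return_pmf (Suc T))) y \<noteq> 0"
  shows "Suc T - t \<le> y \<and> y \<le> Suc T + t"
  using assms(3-5)
proof (induction t arbitrary: y)
  case 0
  then show ?case by (auto simp: indicator_def split: if_splits)
next
  case (Suc t)
  let ?P = "hom_chain qc ql r d n M"
  let ?\<mu> = "(dist_step {..<n} ?P ^^ t) (pmf (return_pmf (Suc T)))"
  have "(\<Sum>x<n. ?\<mu> x * ?P x y) = dist_step {..<n} ?P ?\<mu> y"
    by (rule dist_step_def[THEN fun_cong, symmetric])
  also have "\<dots> \<noteq> 0" using Suc.prems(3) by (simp only: funpow.simps o_apply not_False_eq_True)
  finally obtain x where x: "x < n" "?\<mu> x \<noteq> 0" "?P x y \<noteq> 0"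
    by (auto elim!: sum.not_neutral_contains_not_neutral simp del: pmf_return)
  then have IH: "Suc T - t \<le> x" "x \<le> Suc T + t" using Suc.IH[of x] Suc.prems(1) by (simp_all del: pmf_return)
  have xn: "Suc x < n" using IH T Suc.prems(1) spacing_ge spacing_le by linarith
  have "x \<notin> hubs \<alpha> n"
  proof
    assume "x \<in> hubs \<alpha> n"
    then obtain i where i: "i < m" "x = p i" by (auto simp: hubs_eq)
    \<comment> \<open>Here \<open>x \<ge> 2\<close> excludes hub 0, and every other hub lies beyond
      \<open>G / 2 - 1 \<ge> 2 * T + 1\<close>, whereas \<open>x \<le> 2 * T\<close>.\<close>
    have "i \<noteq> 0" using i IH Suc.prems(1) hub_pos_0 by (cases i) auto
    then have "1 * (G / 2) \<le> real i * (G / 2)" by (intro mult_right_mono) auto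
    also have "\<dots> < real x + 1" using hub_pos_bounds(2)[OF i(1)] i(2) by simp
    finally show False using IH T Suc.prems(1) by linarith
  qed
  then have "{x, y} \<notin> M" using M by (auto simp: perfect_matchings_def partition_on_def)
  then have "y = x \<or> y = Suc x mod n \<or> x = Suc y mod n"
    using x(3) by (auto simp: hom_chain_def move_prob_def split: if_splits)
  \<comment> \<open>Together with \<open>Suc x < n\<close> this rules out that a cycle step wraps
    around.\<close>
  moreover have "x \<noteq> 0" using IH Suc.prems(1) by simp
  ultimately have "y = x \<or> y = Suc x \<or> x = Suc y"
    using xn Suc.prems(2) by (auto simp: mod_Suc split: if_splits)
  then show ?case using IH Suc.prems(1) by auto
qed

text \<open>The hypothesis \<open>chain\<close> identifies the stationary distribution as uniform.
  The set holding all the mass has at most \<open>G\<close> elements, so the distance stays at least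
  \<open>1 - G / n\<close>.\<close>

lemma t_mix_lower:
  assumes chain: "poincare_chain {..<n} (hom_chain qc ql r d n M) gap"
    and M: "M \<in> perfect_matchings (hubs \<alpha> n)"
    and \<epsilon>: "\<epsilon> < 1 - G / real n"
  shows "ereal (1 / 16 * G) < ereal_of_enat (t_mix {..<n} (hom_chain qc ql r d n M) \<epsilon>)"
proof -
  interpret poincare_chain "{..<n}" "hom_chain qc ql r d n M" gap by (rule chain)
  \<comment> \<open>Failure at all times up to \<open>T\<close> gives mixing time at least
    \<open>T + 1 > G / 16\<close>; this is why rounding down still yields a strict bound.\<close>
  define T where "T = nat \<lfloor>G / 16\<rfloor>"
  have T: "real T \<le> G / 16" "G / 16 < real T + 1" 
    using nat_floor_bounds[of "G / 16"] by (simp_all add: T_def)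
  then have T2: "2 * real T + 2 \<le> G / 2" using spacing_ge by linarith
  let ?\<sigma> = "return_pmf (Suc T)" and ?P = "hom_chain qc ql r d n M"
  have Tn: "Suc (2 * T) < n" using T2 spacing_le spacing_ge by linarith
  then have \<sigma>: "?\<sigma> \<in> distributions_on {..<n}" by (simp add: distributions_on_def)
  have "\<epsilon> < tv_norm {..<n} ((dist_step {..<n} ?P ^^ k) (pmf ?\<sigma>)) (pmf (stationary_dist {..<n} ?P))"
    if k: "k \<le> T" for k
  proof -
    let ?\<mu> = "(dist_step {..<n} ?P ^^ k) (pmf ?\<sigma>)" and ?A = "{..Suc (2 * T)}"
    have A: "?A \<subseteq> {..<n}" using Tn by auto
    have "sum ?\<mu> ?A = sum ?\<mu> {..<n}"
      using hom_chain_stays_in_segment[OF M T2 k] k A by (intro sum.mono_neutral_left) fastforce+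
    also have "\<dots> = 1"
      using \<sigma> by (simp only: sum_dist_step_funpow sum_pmf_distributions_on finite_states)
    finally have "sum ?\<mu> ?A = 1" .
    moreover have "sum (pmf (stationary_dist {..<n} ?P)) ?A = real (Suc (Suc (2 * T))) / real n"
    proof -
      have "sum (pmf (stationary_dist {..<n} ?P)) ?A = (\<Sum>x\<in>?A. 1 / real n)"
        using A states_nonempty by (intro sum.cong refl) (auto simp: stationary_dist_uniform indicator_def)
      then show ?thesis by simp
    qed
    moreover have "real (Suc (Suc (2 * T))) / real n \<le> G / real n"
      using T2 spacing_ge by (intro divide_right_mono) auto
    ultimately have "\<epsilon> < \<bar>sum ?\<mu> ?A - sum (pmf (stationary_dist {..<n} ?P)) ?A\<bar>"
      using \<epsilon> by linarith
    also have "\<dots> \<le> tv_norm {..<n} ?\<mu> (pmf (stationary_dist {..<n} ?P))"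
      using A by (intro tv_norm_ge) auto
    finally show ?thesis .
  qed
  \<comment> \<open>A single starting point suffices under the supremum. If no time were good, the
    infimum would be infinite and the bound would still hold.\<close>
  then have "enat (Suc T) \<le> t_mix {..<n} ?P \<epsilon>"
    unfolding t_mix_def
    by (intro SUP_upper2[OF \<sigma>] INF_greatest) (metis enat_ord_simps(1) mem_Collect_eq not_less not_less_eq_eq)
  then have "ereal_of_enat (enat (Suc T)) \<le> ereal_of_enat (t_mix {..<n} ?P \<epsilon>)"
    by (simp only: ereal_of_enat_le_iff)
  moreover have "ereal (1 / 16 * G) < ereal_of_enat (enat (Suc T))" using T by simp
  ultimately show ?thesis by (rule less_le_trans[rotated])
qed

text \<open>The main term is linear in \<open>d\<close> and is weakened to \<open>d\<^sup>2\<close>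
  by \<open>d \<ge> 1\<close>. The summand 1 in the constant absorbs rounding \<open>k\<close> up,
  as \<open>d\<^sup>2 * G\<^sup>2 * ln n \<ge> 1\<close>.\<close>

lemma t_mix_upper:
  assumes chain: "poincare_chain {..<n} (hom_chain qc ql r d n M) (\<kappa> / (C * d * G\<^sup>2))"
    and \<kappa>: "\<kappa> > 0" "C > 0" and d: "d \<ge> 1" and \<epsilon>: "\<epsilon> > 0" "1 / real n \<le> \<epsilon>\<^sup>2"
  shows "ereal_of_enat (t_mix {..<n} (hom_chain qc ql r d n M) \<epsilon>)
    < ereal ((4 * C / \<kappa> + 1) * d\<^sup>2 * real n powr (2 * \<alpha> - 2) * ln (real n))"
proof -
  define gap where "gap = \<kappa> / (C * d * G\<^sup>2)"
  interpret poincare_chain "{..<n}" "hom_chain qc ql r d n M" gap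
    unfolding gap_def by (rule chain)
  have G: "G \<ge> 1" using spacing_ge by simp
  have G2: "real n powr (2 * \<alpha> - 2) = G\<^sup>2"
    by (simp add: power2_eq_square powr_add[symmetric])
  have n0: "real n > 0" using n_ge by simp
  have "exp 1 \<le> real n" using exp_le n_ge by linarith
  then have ln1: "ln (real n) \<ge> 1" using n0 by (simp add: ln_ge_iff)
  \<comment> \<open>This time makes \<open>exp (- gap * k / 2)\<close> at most
    \<open>1 / n\<^sup>2\<close>; one power of \<open>n\<close> pays for the number of states and
    the other one gets below \<open>\<epsilon>\<^sup>2\<close>.\<close>
  define k where "k = nat \<lceil>4 * ln (real n) / gap\<rceil>"
  have k: "4 * ln (real n) / gap \<le> real k" "real k < 4 * ln (real n) / gap + 1"
  proof -
    have "0 \<le> 4 * ln (real n) / gap" using gap_pos ln1 by simp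
    then show "4 * ln (real n) / gap \<le> real k" "real k < 4 * ln (real n) / gap + 1"
      unfolding k_def by linarith+
  qed
  have "2 * ln (real n) \<le> gap * real k / 2"
    using k(1) gap_pos by (simp add: field_simps)
  then have "exp (- gap * real k / 2) \<le> exp (- (2 * ln (real n)))" by simp
  also have "\<dots> = 1 / (real n)\<^sup>2"
    using n0 by (simp add: exp_minus exp_of_nat_mult[of 2, simplified] divide_simps)
  finally have "real n * exp (- gap * real k / 2) \<le> real n * (1 / (real n)\<^sup>2)"
    by (intro mult_left_mono) auto
  also have "\<dots> = 1 / real n" by (simp add: power2_eq_square)
  also have "\<dots> \<le> \<epsilon>\<^sup>2" by (rule \<epsilon>)
  finally have "t_mix {..<n} (hom_chain qc ql r d n M) \<epsilon> \<le> enat k"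
    by (intro t_mix_le) (simp_all add: \<epsilon>)
  then have "ereal_of_enat (t_mix {..<n} (hom_chain qc ql r d n M) \<epsilon>) \<le> ereal_of_enat (enat k)"
    by (simp only: ereal_of_enat_le_iff)
  also have "\<dots> = ereal (real k)" by simp
  also have "real k < (4 * C / \<kappa> + 1) * d\<^sup>2 * real n powr (2 * \<alpha> - 2) * ln (real n)"
  proof -
    have "1 * 1 \<le> d\<^sup>2 * G\<^sup>2" using d G by (intro mult_mono) auto
    then have one: "1 * 1 \<le> d\<^sup>2 * G\<^sup>2 * ln (real n)" using ln1 by (intro mult_mono) auto
    have "d * 1 \<le> d * d" using d by (intro mult_left_mono) auto
    then have "4 * C / \<kappa> * G\<^sup>2 * ln (real n) * d \<le> 4 * C / \<kappa> * G\<^sup>2 * ln (real n) * d\<^sup>2"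
      using \<kappa> ln1 by (intro mult_left_mono) (auto simp: power2_eq_square)
    moreover have "4 * ln (real n) / gap = 4 * C / \<kappa> * G\<^sup>2 * ln (real n) * d"
      by (simp add: gap_def)
    ultimately have "real k < 4 * C / \<kappa> * G\<^sup>2 * ln (real n) * d\<^sup>2 + d\<^sup>2 * G\<^sup>2 * ln (real n)"
      using k(2) one by linarith
    then show ?thesis unfolding G2 by (simp add: algebra_simps)
  qed
  finally show ?thesis by simp
qed

end

section \<open>Asymptotics in n and asymptotically almost sure events\<close>

lemma eventually_hub_cycle:
  assumes "1 < \<alpha>" "\<alpha> < 2"
  shows "eventually (\<lambda>n. hub_cycle \<alpha> n) sequentially"
proof -
  have "filterlim (\<lambda>n. real n powr (\<alpha> - 1)) at_top sequentially"
    "filterlim (\<lambda>n. real n powr (2 - \<alpha>)) at_top sequentially"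
    using assms by real_asymp+
  then have "eventually (\<lambda>n. real n powr (\<alpha> - 1) \<ge> 9) sequentially"
    "eventually (\<lambda>n. real n powr (2 - \<alpha>) \<ge> 1) sequentially"
    by (auto simp: filterlim_at_top)
  then show ?thesis using eventually_ge_at_top[of 3] by eventually_elim unfold_locales
qed

lemma prob_conj_ge:
  "measure_pmf.prob D {M. A M} + measure_pmf.prob D {M. B M} - 1 \<le> measure_pmf.prob D {M. A M \<and> B M}"
proof -
  have "measure_pmf.prob D ({M. A M} \<union> {M. B M}) =
      measure_pmf.prob D {M. A M} + measure_pmf.prob D ({M. B M} - {M. A M})"
    by (intro measure_pmf.finite_measure_Union') auto
  also have "measure_pmf.prob D ({M. B M} - {M. A M}) =
      measure_pmf.prob D {M. B M} - measure_pmf.prob D ({M. B M} \<inter> {M. A M})"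
    by (intro measure_pmf.finite_measure_Diff') auto
  also have "{M. B M} \<inter> {M. A M} = {M. A M \<and> B M}" by auto
  finally show ?thesis
    using measure_pmf.prob_le_1[of D "{M. A M} \<union> {M. B M}"] by simp
qed

lemma aas_M1_conj:
  assumes "aas_M1 \<alpha> A" "aas_M1 \<alpha> B"
  shows "aas_M1 \<alpha> (\<lambda>n M. A n M \<and> B n M)"
  unfolding aas_M1_def
proof (rule tendsto_sandwich[where h = "\<lambda>_. 1"])
  show "(\<lambda>n. measure_pmf.prob (M1 \<alpha> n) {M. A n M} + measure_pmf.prob (M1 \<alpha> n) {M. B n M} - 1) \<longlonglongrightarrow> 1"
    using tendsto_diff[OF tendsto_add[OF assms[unfolded aas_M1_def]] tendsto_const[of 1]] by simp
qed (auto intro!: always_eventually prob_conj_ge)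

text \<open>The implication is demanded only on the support, so that \<open>M\<close> may be assumed
  to be a perfect matching of the hubs.\<close>

lemma aas_M1_mono:
  assumes "aas_M1 \<alpha> A"
    and "eventually (\<lambda>n. \<forall>M\<in>set_pmf (M1 \<alpha> n). A n M \<longrightarrow> B n M) sequentially"
  shows "aas_M1 \<alpha> B"
  unfolding aas_M1_def
proof (rule tendsto_sandwich[where h = "\<lambda>_. 1"])
  show "(\<lambda>n. measure_pmf.prob (M1 \<alpha> n) {M. A n M}) \<longlonglongrightarrow> 1"
    using assms(1) by (simp add: aas_M1_def)
  show "eventually (\<lambda>n. measure_pmf.prob (M1 \<alpha> n) {M. A n M} \<le> measure_pmf.prob (M1 \<alpha> n) {M. B n M}) sequentially"
    using assms(2)
  proof eventually_elim
    case (elim n)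
    then show ?case
      by (intro measure_pmf.finite_measure_mono_AE) (auto simp: AE_measure_pmf_iff)
  qed
qed (auto intro!: always_eventually)

lemma aas_M1_expanding:
  assumes "1 < \<alpha>" "\<alpha> < 2"
  shows "aas_M1 \<alpha> (expanding_matching \<alpha>)"
  unfolding aas_M1_def
proof (rule tendsto_sandwich[where h = "\<lambda>_. 1"])
  define C where "C = 4 * (\<Sum>s. real s * exp (- ln 2 / 4) ^ s)"
  have "filterlim (\<lambda>n. 2 * (real n powr (2 - \<alpha>) - 1)) at_top sequentially"
    using assms by real_asymp
  moreover have "2 * (real n powr (2 - \<alpha>) - 1) \<le> real (num_hubs \<alpha> n)" for n
    unfolding num_hubs_def of_nat_mult of_nat_numeral
    using nat_floor_bounds(2)[OF powr_ge_zero, of "real n" "2 - \<alpha>"]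
    by (intro mult_left_mono) (simp_all only: diff_le_eq less_imp_le zero_le_numeral)
  ultimately have "filterlim (\<lambda>n. real (num_hubs \<alpha> n)) at_top sequentially"
    by (metis (no_types, lifting) filterlim_at_top_mono always_eventually)
  then have "filterlim (\<lambda>n. sqrt (real (num_hubs \<alpha> n))) at_top sequentially"
    by (rule filterlim_compose[OF sqrt_at_top])
  then have "(\<lambda>n. C / sqrt (real (num_hubs \<alpha> n))) \<longlonglongrightarrow> 0"
    by (rule real_tendsto_divide_at_top[OF tendsto_const])
  then show "(\<lambda>n. 1 - C / sqrt (real (num_hubs \<alpha> n))) \<longlonglongrightarrow> 1"
    using tendsto_diff[OF tendsto_const[of 1]] by fastforce
  show "eventually (\<lambda>n. 1 - C / sqrt (real (num_hubs \<alpha> n)) \<le>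
      measure_pmf.prob (M1 \<alpha> n) {M. expanding_matching \<alpha> n M}) sequentially"
    using eventually_hub_cycle[OF assms]
  proof eventually_elim
    case (elim n)
    have "measure_pmf.prob (M1 \<alpha> n) {M. \<not> expanding_matching \<alpha> n M} =
        1 - measure_pmf.prob (M1 \<alpha> n) {M. expanding_matching \<alpha> n M}"
      using measure_pmf.prob_compl[of "{M. expanding_matching \<alpha> n M}" "M1 \<alpha> n"]
      by (simp add: Collect_neg_eq Compl_eq_Diff_UNIV)
    with hub_cycle.prob_not_expanding_le[OF elim] show ?case by (simp add: C_def)
  qed
qed (auto intro!: always_eventually)

text \<open>For some large \<open>n\<close> the degree event has positive probability, so an actual
  perfect matching satisfies it; the edge at hub 0 then forces \<open>1 \<le> d\<close>.\<close>

lemma long_degree_bound_ge_1: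
  assumes "1 < \<alpha>" "\<alpha> < 2" "aas_M1 \<alpha> (long_degree_le d)"
  shows "d \<ge> 1"
proof -
  have "eventually (\<lambda>n. measure_pmf.prob (M1 \<alpha> n) {M. long_degree_le d n M} > 0) sequentially"
    using assms(3) unfolding aas_M1_def by (rule order_tendstoD) simp
  then have "eventually (\<lambda>n. hub_cycle \<alpha> n \<and> measure_pmf.prob (M1 \<alpha> n) {M. long_degree_le d n M} > 0) sequentially"
    using eventually_hub_cycle[OF assms(1,2)] by eventually_elim simp
  then obtain n where n: "hub_cycle \<alpha> n" "measure_pmf.prob (M1 \<alpha> n) {M. long_degree_le d n M} > 0"
    by (auto dest: eventually_happens)
  interpret hub_cycle \<alpha> n by (rule n(1))
  have "set_pmf (M1 \<alpha> n) \<inter> {M. long_degree_le d n M} \<noteq> {}"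
    using n(2) measure_Int_set_pmf[of "M1 \<alpha> n" "{M. long_degree_le d n M}"] by (auto simp: Int_commute)
  then obtain M where M: "M \<in> perfect_matchings (hubs \<alpha> n)" "long_degree_le d n M"
    by (auto simp: set_pmf_M1)
  have "p 0 \<in> hubs \<alpha> n" using m_pos by (auto simp: hubs_eq)
  then obtain e where e: "e \<in> M" "0 \<in> e"
    using M(1) hub_pos_0 by (auto simp: perfect_matchings_def partition_on_def)
  have "finite (hubs \<alpha> n)" by (simp add: hubs_eq)
  then have "finite M"
    using M(1) by (intro finite_subset[of M "Pow (hubs \<alpha> n)"])
      (auto simp: perfect_matchings_def partition_on_def)
  then have "card {e} \<le> card {e \<in> M. 0 \<in> e}" using e by (intro card_mono) auto
  moreover have "real (card {e \<in> M. 0 \<in> e}) \<le> d" using M(2) n_ge by (simp add: long_degree_le_def)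
  ultimately show ?thesis by simp
qed

theorem theorem22:
  fixes \<alpha> \<epsilon> q\<^sub>c q\<^sub>l r :: real
  assumes "1 < \<alpha>" and "\<alpha> < 2"
    and "0 < \<epsilon>" and "\<epsilon> < 1"
    and "q\<^sub>c > 0" and "q\<^sub>l > 0" and "\<bar>r\<bar> \<le> q\<^sub>c" and "2 * q\<^sub>c + q\<^sub>l \<le> 1"
  shows "\<exists>c\<^sub>1>0. \<exists>c\<^sub>2>0. \<forall>d::real.
    aas_M1 \<alpha> (long_degree_le d) \<longrightarrow>
    aas_M1 \<alpha> (\<lambda>n M. lazy_chain {..<n} (hom_chain q\<^sub>c q\<^sub>l r d n M)) \<longrightarrow>
    aas_M1 \<alpha> (\<lambda>n M.
      ereal (c\<^sub>1 * real n powr (\<alpha> - 1))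
        < ereal_of_enat (t_mix {..<n} (hom_chain q\<^sub>c q\<^sub>l r d n M) \<epsilon>) \<and>
      ereal_of_enat (t_mix {..<n} (hom_chain q\<^sub>c q\<^sub>l r d n M) \<epsilon>)
        < ereal (c\<^sub>2 * d\<^sup>2 * real n powr (2 * \<alpha> - 2) * ln (real n)))"
proof -
  define \<kappa> where "\<kappa> = min (2 * q\<^sub>c) q\<^sub>l"
  have \<kappa>: "\<kappa> > 0" using assms by (simp add: \<kappa>_def)
  \<comment> \<open>The witnesses come from \<open>t_mix_lower\<close> and from
    \<open>t_mix_upper\<close> with \<open>C = 3145736\<close>. They do not involve
    \<open>d\<close>, so they can be chosen before it.\<close>
  show ?thesis
  proof (rule exI[of _ "1 / 16"], intro conjI, simp, rule exI[of _ "4 * 3145736 / \<kappa> + 1"],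
      intro conjI allI impI)
    show "0 < 4 * 3145736 / \<kappa> + 1" using \<kappa> by (simp add: add_pos_pos)
    fix d :: real
    assume deg: "aas_M1 \<alpha> (long_degree_le d)"
      and lazy: "aas_M1 \<alpha> (\<lambda>n M. lazy_chain {..<n} (hom_chain q\<^sub>c q\<^sub>l r d n M))"
    have d: "d \<ge> 1" by (rule long_degree_bound_ge_1[OF assms(1,2) deg])
    \<comment> \<open>Since \<open>\<alpha> < 2\<close>, a segment is a vanishing fraction of the
      cycle, so the distance bound \<open>1 - G / n\<close> eventually exceeds
      \<open>\<epsilon>\<close>.\<close>
    have "(\<lambda>n. real n powr (\<alpha> - 1) / real n) \<longlonglongrightarrow> 0" using assms(1,2) by real_asymp
    then have e1: "eventually (\<lambda>n. real n powr (\<alpha> - 1) / real n < 1 - \<epsilon>) sequentially"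
      using assms(4) by (intro order_tendstoD) auto
    have "(\<lambda>n. 1 / real n) \<longlonglongrightarrow> 0" by real_asymp
    then have e2: "eventually (\<lambda>n. 1 / real n < \<epsilon>\<^sup>2) sequentially"
      using assms(3) by (intro order_tendstoD) auto
    show "aas_M1 \<alpha> (\<lambda>n M.
      ereal (1 / 16 * real n powr (\<alpha> - 1))
        < ereal_of_enat (t_mix {..<n} (hom_chain q\<^sub>c q\<^sub>l r d n M) \<epsilon>) \<and>
      ereal_of_enat (t_mix {..<n} (hom_chain q\<^sub>c q\<^sub>l r d n M) \<epsilon>)
        < ereal ((4 * 3145736 / \<kappa> + 1) * d\<^sup>2 * real n powr (2 * \<alpha> - 2) * ln (real n)))"
    proof (rule aas_M1_mono[OF aas_M1_conj[OF lazy aas_M1_expanding[OF assms(1,2)]]])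
      show "eventually (\<lambda>n. \<forall>M\<in>set_pmf (M1 \<alpha> n).
          lazy_chain {..<n} (hom_chain q\<^sub>c q\<^sub>l r d n M) \<and> expanding_matching \<alpha> n M \<longrightarrow>
          ereal (1 / 16 * real n powr (\<alpha> - 1))
            < ereal_of_enat (t_mix {..<n} (hom_chain q\<^sub>c q\<^sub>l r d n M) \<epsilon>) \<and>
          ereal_of_enat (t_mix {..<n} (hom_chain q\<^sub>c q\<^sub>l r d n M) \<epsilon>)
            < ereal ((4 * 3145736 / \<kappa> + 1) * d\<^sup>2 * real n powr (2 * \<alpha> - 2) * ln (real n))) sequentially"
        using eventually_hub_cycle[OF assms(1,2)] e1 e2
      proof eventually_elim
        case (elim n)
        interpret hub_cycle \<alpha> n by (rule elim(1))
        show ?case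
        proof (intro ballI impI)
          fix M assume "M \<in> set_pmf (M1 \<alpha> n)"
            and M: "lazy_chain {..<n} (hom_chain q\<^sub>c q\<^sub>l r d n M) \<and> expanding_matching \<alpha> n M"
          then have M': "M \<in> perfect_matchings (hubs \<alpha> n)" by (simp add: set_pmf_M1)
          have chain: "poincare_chain {..<n} (hom_chain q\<^sub>c q\<^sub>l r d n M)
              (\<kappa> / (3145736 * d * (real n powr (\<alpha> - 1))\<^sup>2))"
            unfolding \<kappa>_def using assms d M M' by (intro hom_chain_poincare) auto
          show "ereal (1 / 16 * real n powr (\<alpha> - 1))
              < ereal_of_enat (t_mix {..<n} (hom_chain q\<^sub>c q\<^sub>l r d n M) \<epsilon>) \<and>
            ereal_of_enat (t_mix {..<n} (hom_chain q\<^sub>c q\<^sub>l r d n M) \<epsilon>)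
              < ereal ((4 * 3145736 / \<kappa> + 1) * d\<^sup>2 * real n powr (2 * \<alpha> - 2) * ln (real n))"
            using t_mix_lower[OF chain M'] t_mix_upper[OF chain \<kappa> _ d] assms elim by auto
        qed
      qed
    qed
  qed
qed

end
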